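(* Let $\mu\in\mathbb{R}$, $\sigma>0$, $s_0>0$. Let $S(t)=s_0\exp\left((\mu-\sigma^2/2)t+\sigma B(t)\right)$, and for each integer $m\ge0$ let $S_m$ be defined at the time instants $t_k=k2^{-2m}$ ($k\ge0$) by $$S_m(t_0)=s_0,\qquad S_m(t_{k+1})=S_m(t_k)\left\{1+\mu2^{-2m}+\sigma\left(B_m(t_{k+1})-B_m(t_k)\right)\right\},$$ and linearly interpolated between these time instants, where $B_m$ are the ``twist and shrink'' random walks and $B$ is their limiting Brownian motion. Then for any $T>0$, as $m\to\infty$, $$\sup_{0\le t\le T}|S_m(t)-S(t)|=O\left(m^{3/4}2^{-m/2}\right)\quad\text{almost surely.}$$
   Context: ``Twist and shrink'' construction. Let $X_m(k)$ ($m\ge0$, $k\ge1$) be i.i.d. with $\mathbb{P}(X_m(k)=\pm1)=\frac12$ on a complete probability space $(\Omega,\mathcal F,\mathbb{P})$, and let $Y_m(n)=\sum_{k=1}^nX_m(k)$, $Y_m(0)=0$. For $m\ge1$ let $T_m(0)=0$, $T_m(k+1)=\min\{n>T_m(k):|Y_m(n)-Y_m(T_m(k))|=2\}$. Put $\widetilde X_0=X_0$, and recursively for $m\ge1$ and $T_m(k)<n\le T_m(k+1)$ put $\widetilde X_m(n)=X_m(n)$ if $Y_m(T_m(k+1))-Y_m(T_m(k))=2\widetilde X_{m-1}(k+1)$, and $\widetilde X_m(n)=-X_m(n)$ otherwise. Let $\widetilde Y_m(n)=\sum_{j\le n}\widetilde X_m(j)$, extended to real times by linear interpolation, and $B_m(t)=2^{-m}\widetilde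 Y_m(t2^{2m})$. It is known from earlier work that each $\widetilde Y_m$ is a simple symmetric random walk and that $B_m$ converges to a Brownian motion $B$ uniformly on bounded intervals, almost surely, with $\sup_{0\le t\le T}|B(t)-B_m(t)|=O(m^{3/4}2^{-m/2})$ a.s. for every fixed $T>0$. The constant in $O(\cdot)$ may depend on $\omega\in\Omega$. *)

theory Defs
  imports "HOL-Probability.Probability" "HOL-Library.Landau_Symbols"
begin

definition lin_interp :: "(nat \<Rightarrow> real) \<Rightarrow> real \<Rightarrow> real" where
  "lin_interp f s = (let k = nat \<lfloor>s\<rfloor> in f k + (s - real k) * (f (Suc k) - f k))"

text \<open>
  The construction is defined path by path: \<open>x m k\<close> stands for the value of \<open>X\<^sub>m(k)\<close> at a
  fixed outcome. Only the indices \<open>k \<ge> 1\<close> are used.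
\<close>

definition walk :: "(nat \<Rightarrow> nat \<Rightarrow> real) \<Rightarrow> nat \<Rightarrow> nat \<Rightarrow> real" where
  "walk x m n = (\<Sum>k=1..n. x m k)"

text \<open>
  For independent symmetric signs the set below is nonempty, hence the \<open>LEAST\<close> is
  a genuine minimum, for all \<open>m\<close> and \<open>k\<close> almost surely; on the exceptional null set the value
  is unspecified.
\<close>

primrec stop_time :: "(nat \<Rightarrow> nat \<Rightarrow> real) \<Rightarrow> nat \<Rightarrow> nat \<Rightarrow> nat" where
  "stop_time x m 0 = 0"
| "stop_time x m (Suc k) =
     (LEAST n. n > stop_time x m k \<and> \<bar>walk x m n - walk x m (stop_time x m k)\<bar> = 2)"

primrec twisted :: "(nat \<Rightarrow> nat \<Rightarrow> real) \<Rightarrow> nat \<Rightarrow> nat \<Rightarrow> real" where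
  "twisted x 0 n = x 0 n"
| "twisted x (Suc m) n =
     (let k = (THE k. stop_time x (Suc m) k < n \<and> n \<le> stop_time x (Suc m) (Suc k))
      in if walk x (Suc m) (stop_time x (Suc m) (Suc k)) - walk x (Suc m) (stop_time x (Suc m) k)
              = 2 * twisted x m (Suc k)
         then x (Suc m) n else - x (Suc m) n)"

definition twisted_walk :: "(nat \<Rightarrow> nat \<Rightarrow> real) \<Rightarrow> nat \<Rightarrow> nat \<Rightarrow> real" where
  "twisted_walk x m n = (\<Sum>j=1..n. twisted x m j)"

definition twist_shrink :: "(nat \<Rightarrow> nat \<Rightarrow> real) \<Rightarrow> nat \<Rightarrow> real \<Rightarrow> real" where
  "twist_shrink x m t = lin_interp (twisted_walk x m) (t * 2 ^ (2 * m)) / 2 ^ m"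

definition (in prob_space) brownian_motion :: "(real \<Rightarrow> 'a \<Rightarrow> real) \<Rightarrow> bool" where
  "brownian_motion B \<longleftrightarrow>
     (\<forall>t\<ge>0. random_variable borel (B t)) \<and>
     (AE \<omega> in M. B 0 \<omega> = 0) \<and>
     (\<forall>s t. 0 \<le> s \<and> s < t \<longrightarrow>
        distributed M lborel (\<lambda>\<omega>. B t \<omega> - B s \<omega>)
          (\<lambda>z. ennreal (normal_density 0 (sqrt (t - s)) z))) \<and>
     (\<forall>(n::nat) (\<tau> :: nat \<Rightarrow> real). 0 \<le> \<tau> 0 \<and> (\<forall>i<n. \<tau> i < \<tau> (Suc i)) \<longrightarrow>
        indep_vars (\<lambda>_. borel) (\<lambda>i \<omega>. B (\<tau> (Suc i)) \<omega> - B (\<tau> i) \<omega>) {..<n}) \<and>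
     (AE \<omega> in M. continuous_on {0..} (\<lambda>t. B t \<omega>))"

definition geometric_bm :: "real \<Rightarrow> real \<Rightarrow> real \<Rightarrow> (real \<Rightarrow> real) \<Rightarrow> real \<Rightarrow> real" where
  "geometric_bm \<mu> \<sigma> s\<^sub>0 b t = s\<^sub>0 * exp ((\<mu> - \<sigma>\<^sup>2 / 2) * t + \<sigma> * b t)"

text \<open>\<open>price_grid \<mu> \<sigma> s\<^sub>0 b m k\<close> is the value at time \<open>k / 2 ^ (2 * m)\<close>, where \<open>b\<close> is the driving
  path of level \<open>m\<close>.\<close>

primrec price_grid ::
  "real \<Rightarrow> real \<Rightarrow> real \<Rightarrow> (real \<Rightarrow> real) \<Rightarrow> nat \<Rightarrow> nat \<Rightarrow> real" where
  "price_grid \<mu> \<sigma> s\<^sub>0 b m 0 = s\<^sub>0"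
| "price_grid \<mu> \<sigma> s\<^sub>0 b m (Suc k) = price_grid \<mu> \<sigma> s\<^sub>0 b m k *
     (1 + \<mu> / 2 ^ (2 * m) + \<sigma> * (b (real (Suc k) / 2 ^ (2 * m)) - b (real k / 2 ^ (2 * m))))"

definition discrete_price ::
  "real \<Rightarrow> real \<Rightarrow> real \<Rightarrow> (real \<Rightarrow> real) \<Rightarrow> nat \<Rightarrow> real \<Rightarrow> real" where
  "discrete_price \<mu> \<sigma> s\<^sub>0 b m t = lin_interp (price_grid \<mu> \<sigma> s\<^sub>0 b m) (t * 2 ^ (2 * m))"

end

theory Submission
  imports Defs "HOL-Real_Asymp.Real_Asymp"
begin

text \<open>
  The rate for \<open>B\<^sub>m\<close> is not among the hypotheses, and is proved without showing that the twisted
  walks are simple random walks. The stopping times of level \<open>m\<close> are twice the positions of the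
  pairs \<open>X\<^sub>m(2l-1) = X\<^sub>m(2l)\<close>, so at time \<open>n\<close> the walk of level \<open>m\<close> is within 1 of twice the walk
  of level \<open>m - 1\<close> at the number \<open>N\<^sub>m(n div 2)\<close> of such pairs up to \<open>n div 2\<close>. Hoeffding's inequality and
  Borel-Cantelli bound all increments of \<open>N\<^sub>m - n/2\<close> on windows of length \<open>L\<close> by \<open>O(sqrt (m L))\<close>.
  Descending through the levels until the window has length of order \<open>m\<close>, where
  the trivial bound on increments is good enough, yields increments \<open>O(sqrt (m L))\<close> for the twisted
  walk as well. With \<open>L\<close> of order \<open>sqrt m * 2 ^ m\<close>, the size of the time distortion between two
  levels, consecutive \<open>B\<^sub>m\<close> differ by \<open>O(m\<^bsup>3/4\<^esup> 2\<^bsup>-m/2\<^esup>)\<close>, and these bounds sum geometrically.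
  For the price, \<open>ln (1 + u) = u - u\<^sup>2/2 + O(u\<^sup>3)\<close> turns the product into an exponential of \<open>B\<^sub>m\<close> up to
  an error \<open>O(2\<^bsup>-m\<^esup>)\<close> in the exponent.
\<close>

subsection \<open>Concentration of partial sums\<close>

lemma (in prob_space) Hoeffding_centred:
  fixes Z :: "'i \<Rightarrow> 'a \<Rightarrow> real"
  assumes "finite I" "I \<noteq> {}" "indep_vars (\<lambda>_. borel) Z I"
    and "\<And>i. i \<in> I \<Longrightarrow> AE x in M. \<bar>Z i x\<bar> \<le> 1"
    and "\<And>i. i \<in> I \<Longrightarrow> expectation (Z i) = 0" and "\<epsilon> \<ge> 0"
  shows "prob {x \<in> space M. \<bar>\<Sum>i\<in>I. Z i x\<bar> \<ge> \<epsilon>} \<le> 2 * exp (- \<epsilon>\<^sup>2 / (2 * card I))"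
proof -
  interpret Hoeffding_ineq M I Z "\<lambda>_. -1" "\<lambda>_. 1" 0
  proof unfold_locales
    show "AE x in M. Z i x \<in> {-1..1}" if "i \<in> I" for i
      using assms(4)[OF that] by eventually_elim auto
  qed (use assms in auto)
  have pos: "card I > 0" using assms by (simp add: card_gt_0_iff)
  have "- 2 * \<epsilon>\<^sup>2 / (\<Sum>i\<in>I. (1 - - (1::real))\<^sup>2) = - \<epsilon>\<^sup>2 / (2 * card I)"
    by (simp add: field_simps)
  with Hoeffding_ineq_abs_ge[OF \<open>\<epsilon> \<ge> 0\<close>] pos show ?thesis
    by simp
qed

text \<open>Hoeffding bounds a single window by \<open>2 * exp (- 8 * real r)\<close>. There are at
  most \<open>4 * 64 ^ r\<close> windows below \<open>8 ^ r\<close>, so the union bound is summable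
  and Borel-Cantelli applies. The range \<open>8 ^ r\<close> eventually exceeds every multiple of
  \<open>4 ^ r\<close>, hence every time horizon.\<close>

lemma (in prob_space) AE_eventually_block_sums_le:
  fixes Z :: "nat \<Rightarrow> nat \<Rightarrow> 'a \<Rightarrow> real"
  assumes ind: "\<And>r. indep_vars (\<lambda>_. borel) (Z r) {1..}"
    and bd: "\<And>r i. i \<ge> 1 \<Longrightarrow> AE x in M. \<bar>Z r i x\<bar> \<le> 1"
    and mean: "\<And>r i. i \<ge> 1 \<Longrightarrow> expectation (Z r i) = 0"
  shows "AE \<omega> in M. \<forall>\<^sub>F r in sequentially. \<forall>b\<le>8 ^ r. \<forall>a\<le>b.
           \<bar>\<Sum>i\<in>{a<..b}. Z r i \<omega>\<bar> \<le> 4 * sqrt (real r * (real b - real a))"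
proof -
  have [measurable]: "Z r i \<in> borel_measurable M" if "i \<ge> 1" for r i
    using ind[of r] that unfolding indep_vars_def by auto
  define V where "V = (\<lambda>r p. {\<omega> \<in> space M.
      4 * sqrt (real r * (real (snd p) - real (fst p))) \<le> \<bar>\<Sum>i\<in>{fst p<..snd p}. Z r i \<omega>\<bar>})"
  define S where "S = (\<lambda>r. {p::nat\<times>nat. fst p < snd p \<and> snd p \<le> 8 ^ r})"
  have Ssub: "S r \<subseteq> {..8^r} \<times> {..8^r}" for r
    unfolding S_def by auto
  have fin: "finite (S r)" for r
    by (rule finite_subset[OF Ssub]) auto
  have "card (S r) \<le> card ({..8^r::nat} \<times> {..8^r::nat})" for r
    by (intro card_mono Ssub) auto
  then have "card (S r) \<le> (8^r + 1) * (8^r + 1)" for r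
    by (simp add: card_cartesian_product)
  moreover have "(8^r + 1) * (8^r + 1) \<le> (2 * 8^r) * (2 * 8^r::nat)" for r
    by (intro mult_mono) auto
  moreover have "(2 * 8^r) * (2 * 8^r) = 4 * (64::nat) ^ r" for r
    by (simp flip: power_mult_distrib)
  ultimately have cardS: "card (S r) \<le> 4 * 64 ^ r" for r
    by (metis order_trans)
  have [measurable]: "V r p \<in> sets M" for r p
    unfolding V_def by measurable
  have pV: "prob (V r p) \<le> 2 * exp (- 8 * real r)" if "p \<in> S r" for r p
  proof -
    obtain a b where p: "p = (a, b)" by (cases p)
    with that have "a < b" by (auto simp: S_def)
    have "prob (V r p) \<le> 2 * exp (- (4 * sqrt (real r * (real b - real a)))\<^sup>2 / (2 * card {a<..b}))"
      unfolding V_def p fst_conv snd_conv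
      by (rule Hoeffding_centred)
        (use \<open>a < b\<close> in \<open>auto intro!: bd mean indep_vars_subset[OF ind]\<close>)
    also have "(4 * sqrt (real r * (real b - real a)))\<^sup>2 = 16 * real r * (real b - real a)"
      using \<open>a < b\<close> by (simp add: power_mult_distrib)
    also have "- (16 * real r * (real b - real a)) / real (2 * card {a<..b}) = - 8 * real r"
      using \<open>a < b\<close> by (simp add: of_nat_diff field_simps)
    finally show ?thesis .
  qed
  have pU: "prob (\<Union>p\<in>S r. V r p) \<le> 8 * (1/4) ^ r" for r
  proof -
    have "prob (\<Union>p\<in>S r. V r p) \<le> (\<Sum>p\<in>S r. prob (V r p))"
      by (rule finite_measure_subadditive_finite) (auto simp: fin)
    also have "\<dots> \<le> real (card (S r)) * (2 * exp (- 8 * real r))"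
      using sum_bounded_above[OF pV] by simp
    also have "\<dots> \<le> (4 * 64 ^ r) * (2 * (1/256) ^ r)"
    proof (rule mult_mono)
      show "real (card (S r)) \<le> 4 * 64 ^ r"
        using cardS[of r] by (metis of_nat_le_iff of_nat_mult of_nat_numeral of_nat_power)
      \<comment> \<open>This gives \<open>exp (- 8) \<le> 1/256\<close>, which beats the growth
        \<open>64 ^ r\<close> of the number of windows.\<close>
      have "(2::real) \<le> exp 1" using exp_ge_add_one_self[of 1] by simp
      then have "(2::real) ^ 8 \<le> exp 1 ^ 8" by (intro power_mono) auto
      also have "exp 1 ^ 8 = exp (8::real)" by (simp flip: exp_of_nat_mult)
      finally have "exp (- 8) \<le> (1/256 :: real)" by (simp add: exp_minus field_simps)
      then have "exp (- 8) ^ r \<le> (1/256 :: real) ^ r" by (intro power_mono) auto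
      then show "2 * exp (- 8 * real r) \<le> 2 * (1/256) ^ r"
        by (simp add: mult.commute flip: exp_of_nat_mult)
    qed auto
    also have "\<dots> = 8 * (1/4) ^ r"
      by (simp flip: power_mult_distrib)
    finally show ?thesis .
  qed
  have "AE \<omega> in M. eventually (\<lambda>r. \<omega> \<in> space M - (\<Union>p\<in>S r. V r p)) sequentially"
  proof (rule borel_cantelli_AE1)
    show "summable (\<lambda>r. prob (\<Union>p\<in>S r. V r p))"
      by (rule summable_comparison_test'[of "\<lambda>r. 8 * (1/4) ^ r"])
        (use pU in \<open>auto intro!: summable_mult summable_geometric\<close>)
  qed (use fin in \<open>auto intro!: sets.finite_UN simp: emeasure_eq_measure\<close>)
  then show ?thesis
  proof eventually_elim
    case (elim \<omega>)
    then show ?case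
    proof eventually_elim
      case (elim r)
      show ?case
      proof (intro allI impI)
        fix b a assume "b \<le> 8 ^ r" "a \<le> (b::nat)"
        show "\<bar>\<Sum>i\<in>{a<..b}. Z r i \<omega>\<bar> \<le> 4 * sqrt (real r * (real b - real a))"
        proof (cases "a = b")
          case False
          with \<open>a \<le> b\<close> \<open>b \<le> 8 ^ r\<close> have "(a, b) \<in> S r" by (auto simp: S_def)
          with elim have "\<omega> \<notin> V r (a, b)" "\<omega> \<in> space M" by auto
          then show ?thesis by (auto simp: V_def)
        qed simp
      qed
    qed
  qed
qed

text \<open>Serves to show that every row has infinitely many pairs of equal signs, so that all
  stopping times exist. Any fraction of \<open>n\<close> below 1 would do for this.\<close>

lemma (in prob_space) AE_eventually_partial_sums_le:
  fixes Z :: "nat \<Rightarrow> 'a \<Rightarrow> real"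
  assumes ind: "indep_vars (\<lambda>_. borel) Z {1..}"
    and bd: "\<And>i. i \<ge> 1 \<Longrightarrow> AE x in M. \<bar>Z i x\<bar> \<le> 1"
    and mean: "\<And>i. i \<ge> 1 \<Longrightarrow> expectation (Z i) = 0"
  shows "AE \<omega> in M. \<forall>\<^sub>F n in sequentially. \<bar>\<Sum>i=1..n. Z i \<omega>\<bar> \<le> real n / 2"
proof -
  have [measurable]: "Z i \<in> borel_measurable M" if "i \<ge> 1" for i
    using ind that unfolding indep_vars_def by auto
  define V where "V = (\<lambda>n. {\<omega> \<in> space M. real n / 2 \<le> \<bar>\<Sum>i=1..n. Z i \<omega>\<bar>})"
  have [measurable]: "V n \<in> sets M" for n
    unfolding V_def by measurable
  have pV: "prob (V n) \<le> 2 * exp (- 1/8) ^ n" for n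
  proof (cases "n = 0")
    case False
    have "prob (V n) \<le> 2 * exp (- (real n / 2)\<^sup>2 / (2 * card {1..n}))"
      unfolding V_def
      by (rule Hoeffding_centred)
        (use False in \<open>auto intro!: bd mean indep_vars_subset[OF ind]\<close>)
    also have "- (real n / 2)\<^sup>2 / (2 * card {1..n}) = real n * (- 1/8)"
      using False by (simp add: power2_eq_square field_simps)
    finally show ?thesis unfolding exp_of_nat_mult .
  qed (use prob_le_1[of "V 0"] in \<open>simp; linarith\<close>)
  have "AE \<omega> in M. eventually (\<lambda>n. \<omega> \<in> space M - V n) sequentially"
  proof (rule borel_cantelli_AE1)
    show "summable (\<lambda>n. prob (V n))"
      by (rule summable_comparison_test'[of "\<lambda>n. 2 * exp (- 1/8) ^ n"])
        (use pV in \<open>auto intro!: summable_mult summable_geometric\<close>)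
  qed (auto simp: emeasure_eq_measure)
  then show ?thesis
  proof eventually_elim
    case (elim \<omega>)
    then show ?case by eventually_elim (auto simp: V_def)
  qed
qed

section \<open>Random signs and products of consecutive signs\<close>

lemma (in prob_space) random_sign_AE:
  fixes Z :: "'a \<Rightarrow> real"
  assumes [measurable]: "Z \<in> borel_measurable M"
    and "prob {\<omega> \<in> space M. Z \<omega> = 1} = 1/2" "prob {\<omega> \<in> space M. Z \<omega> = - 1} = 1/2"
  shows "AE \<omega> in M. Z \<omega> = 1 \<or> Z \<omega> = - 1"
proof -
  have eq: "{\<omega> \<in> space M. Z \<omega> = 1 \<or> Z \<omega> = - 1} = {\<omega> \<in> space M. Z \<omega> = 1} \<union> {\<omega> \<in> space M. Z \<omega> = - 1}"
    by auto
  have "prob {\<omega> \<in> space M. Z \<omega> = 1 \<or> Z \<omega> = - 1} = 1"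
    unfolding eq by (subst finite_measure_Union) (use assms in auto)
  then show ?thesis
    by (subst prob_Collect_eq_1[symmetric]) auto
qed

lemma (in prob_space) random_sign_mean:
  fixes Z :: "'a \<Rightarrow> real"
  assumes [measurable]: "Z \<in> borel_measurable M"
    and p: "prob {\<omega> \<in> space M. Z \<omega> = 1} = 1/2" "prob {\<omega> \<in> space M. Z \<omega> = - 1} = 1/2"
  shows "integrable M Z" "expectation Z = 0"
proof -
  note AE = random_sign_AE[OF assms]
  show "integrable M Z"
  proof (rule integrable_const_bound)
    show "AE x in M. norm (Z x) \<le> 1"
      using AE by eventually_elim auto
  qed simp
  have "expectation Z = expectation (\<lambda>\<omega>. indicator {\<omega> \<in> space M. Z \<omega> = 1} \<omega>
      - indicator {\<omega> \<in> space M. Z \<omega> = - 1} \<omega>)"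
    by (rule integral_cong_AE) (use AE AE_space in \<open>auto simp: indicator_def\<close>)
  also have "\<dots> = 0"
    by (subst Bochner_Integration.integral_diff) (auto simp: p emeasure_eq_measure less_top[symmetric] intro!: integrable_real_indicator)
  finally show "expectation Z = 0" .
qed

text \<open>The product is 1 on a pair of equal signs and -1 on a pair of opposite ones, so its sums
  measure how far \<open>pair_count\<close> is from half the number of pairs. Independence carries
  over because the index blocks \<open>{2 * l - 1, 2 * l}\<close> are disjoint for
  \<open>l \<ge> 1\<close>.\<close>

lemma (in prob_space) pair_products_indep_centred:
  fixes Y :: "nat \<Rightarrow> 'a \<Rightarrow> real"
  assumes ind: "indep_vars (\<lambda>_. borel) Y {1..}"
    and p: "\<And>k. k \<ge> 1 \<Longrightarrow> prob {\<omega> \<in> space M. Y k \<omega> = 1} = 1/2"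
      "\<And>k. k \<ge> 1 \<Longrightarrow> prob {\<omega> \<in> space M. Y k \<omega> = - 1} = 1/2"
  shows "indep_vars (\<lambda>_. borel) (\<lambda>l \<omega>. Y (2 * l - 1) \<omega> * Y (2 * l) \<omega>) {1..}"
    and "\<And>l. l \<ge> 1 \<Longrightarrow> expectation (\<lambda>\<omega>. Y (2 * l - 1) \<omega> * Y (2 * l) \<omega>) = 0"
proof -
  have rv: "random_variable borel (Y i)" if "i \<ge> 1" for i
    using ind that unfolding indep_vars_def by auto
  define K where "K = (\<lambda>l::nat. {2 * l - 1, 2 * l})"
  have "indep_vars (\<lambda>l. PiM (K l) (\<lambda>_. borel)) (\<lambda>l \<omega>. restrict (\<lambda>i. Y i \<omega>) (K l)) {1..}"
  proof (rule indep_vars_restrict[OF ind])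
    show "disjoint_family_on K {1..}"
      unfolding disjoint_family_on_def K_def by (auto; presburger)
  qed (auto simp: K_def)
  then have "indep_vars (\<lambda>_. borel)
      (\<lambda>l \<omega>. (\<lambda>f. f (2 * l - 1) * f (2 * l)) (restrict (\<lambda>i. Y i \<omega>) (K l))) {1..}"
  proof (rule indep_vars_compose2)
    fix l :: nat
    have [simp]: "2 * l - Suc 0 \<in> K l" "2 * l \<in> K l" by (auto simp: K_def)
    show "(\<lambda>f. f (2 * l - 1) * f (2 * l)) \<in> borel_measurable (PiM (K l) (\<lambda>_. borel :: real measure))"
      by (intro borel_measurable_times measurable_component_singleton) auto
  qed
  then show "indep_vars (\<lambda>_. borel) (\<lambda>l \<omega>. Y (2 * l - 1) \<omega> * Y (2 * l) \<omega>) {1..}"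
    by (simp add: K_def)
  fix l :: nat assume l: "l \<ge> 1"
  have sub: "indep_vars (\<lambda>_. borel) Y {2 * l - 1, 2 * l}"
    by (rule indep_vars_subset[OF ind]) (use l in auto)
  have mean: "expectation (Y i) = 0" "integrable M (Y i)" if "i \<ge> 1" for i
    using random_sign_mean[OF rv p] that by auto
  have "expectation (\<lambda>\<omega>. \<Prod>i\<in>{2 * l - 1, 2 * l}. Y i \<omega>) = (\<Prod>i\<in>{2 * l - 1, 2 * l}. expectation (Y i))"
    by (rule indep_vars_lebesgue_integral[OF _ sub]) (use l mean in auto)
  moreover have "2 * l - 1 \<noteq> 2 * l" using l by auto
  ultimately show "expectation (\<lambda>\<omega>. Y (2 * l - 1) \<omega> * Y (2 * l) \<omega>) = 0"
    using mean l by simp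
qed

subsection \<open>Stopping times and twisted walks\<close>

text \<open>Truncated subtraction makes pair 0 equal for every \<open>y\<close>;
  \<open>pair_count\<close> therefore starts at 1.\<close>

definition paired :: "(nat \<Rightarrow> real) \<Rightarrow> nat \<Rightarrow> bool" where
  "paired y l \<longleftrightarrow> y (2 * l - 1) = y (2 * l)"

definition pair_count :: "(nat \<Rightarrow> real) \<Rightarrow> nat \<Rightarrow> nat" where
  "pair_count y n = card {l \<in> {1..n}. paired y l}"

lemma pair_count_0 [simp]: "pair_count y 0 = 0"
  by (simp add: pair_count_def)

lemma pair_count_Suc [simp]:
  "pair_count y (Suc n) = (if paired y (Suc n) then Suc (pair_count y n) else pair_count y n)"
proof -
  have "{l \<in> {1..Suc n}. paired y l} =
      (if paired y (Suc n) then insert (Suc n) {l \<in> {1..n}. paired y l} else {l \<in> {1..n}. paired y l})"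
    by (auto simp: le_Suc_eq)
  then show ?thesis by (auto simp: pair_count_def)
qed

lemma pair_count_mono: "a \<le> b \<Longrightarrow> pair_count y a \<le> pair_count y b"
  by (rule lift_Suc_mono_le[of "pair_count y"]) auto

text \<open>For signs, the indicator of equality is one half of 1 plus the product.\<close>

lemma pair_count_diff:
  assumes "\<And>k. k \<ge> 1 \<Longrightarrow> y k = 1 \<or> y k = -1" "a \<le> b"
  shows "real (pair_count y b) - real (pair_count y a)
    = (real b - real a) / 2 + (\<Sum>l\<in>{a<..b}. y (2 * l - 1) * y (2 * l)) / 2"
  using assms(2)
proof (induction b rule: dec_induct)
  case (step n)
  have eq: "{a<..Suc n} = insert (Suc n) {a<..n}" using step by auto
  have "y (2 * Suc n) = 1 \<or> y (2 * Suc n) = -1" "y (2 * Suc n - 1) = 1 \<or> y (2 * Suc n - 1) = -1"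
    by (intro assms(1); simp)+
  then have "(if paired y (Suc n) then 1 else 0) = 1/2 + y (2 * Suc n - 1) * y (2 * Suc n) / 2"
    unfolding paired_def by auto
  then show ?case
    unfolding eq using step by (auto simp: field_simps)
qed simp

section \<open>Walks, stopping times and blocks along a fixed array of signs\<close>

lemma walk_Suc [simp]: "walk x m (Suc n) = walk x m n + x m (Suc n)"
  by (simp add: walk_def)

lemma twisted_walk_Suc [simp]: "twisted_walk x m (Suc n) = twisted_walk x m n + twisted x m (Suc n)"
  by (simp add: twisted_walk_def)

lemma twisted_walk_0 [simp]: "twisted_walk x m 0 = 0"
  by (simp add: twisted_walk_def)

declare stop_time.simps(2) [simp del]

text \<open>Properties of almost every outcome. The second one makes each \<open>LEAST\<close> in
  \<open>stop_time\<close> a genuine minimum.\<close>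

locale sign_array =
  fixes x :: "nat \<Rightarrow> nat \<Rightarrow> real"
  assumes sign: "\<And>m k. k \<ge> 1 \<Longrightarrow> x m k = 1 \<or> x m k = -1"
    and pairs_unbounded: "\<And>m k. \<exists>n. k \<le> pair_count (x m) n"
begin

lemma twisted_sign: "k \<ge> 1 \<Longrightarrow> twisted x m k = 1 \<or> twisted x m k = -1"
  using sign[of k] by (cases m) (auto simp: Let_def)

lemma twisted_walk_increment_le:
  assumes "a \<le> b"
  shows "\<bar>twisted_walk x m b - twisted_walk x m a\<bar> \<le> real b - real a"
  using assms
proof (induction b rule: dec_induct)
  case (step n)
  then show ?case using twisted_sign[of "Suc n" m] by auto
qed simp

lemma walk_even_constant:
  assumes "p \<le> q" "\<And>l. p < l \<Longrightarrow> l \<le> q \<Longrightarrow> \<not> paired (x m) l"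
  shows "walk x m (2 * q) = walk x m (2 * p)"
  using assms
proof (induction q rule: dec_induct)
  case (step n)
  have "\<not> paired (x m) (Suc n)" using step by auto
  then have "x m (Suc (2 * n)) + x m (Suc (Suc (2 * n))) = 0"
    using sign[of "Suc (2 * n)" m] sign[of "Suc (Suc (2 * n))" m] by (auto simp: paired_def)
  then show ?case using step by simp
qed simp

text \<open>Before the block ends only opposite pairs have occurred: at even times the walk is back
  at its starting value, at odd times it is one step away.\<close>

lemma walk_within_block:
  assumes "2 * p \<le> n" "n < 2 * q" "\<And>l. p < l \<Longrightarrow> l < q \<Longrightarrow> \<not> paired (x m) l"
  shows "\<bar>walk x m n - walk x m (2 * p)\<bar> \<le> 1"
proof -
  have ev: "walk x m (2 * (n div 2)) = walk x m (2 * p)"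
    by (rule walk_even_constant) (use assms in auto)
  show ?thesis
  proof (cases "even n")
    case False
    then have "n = Suc (2 * (n div 2))" by presburger
    then have "walk x m n = walk x m (2 * (n div 2)) + x m n"
      by (metis walk_Suc)
    moreover have "x m n = 1 \<or> x m n = -1" using False by (intro sign) (auto intro: Suc_leI odd_pos)
    ultimately show ?thesis using ev by auto
  qed (use ev in auto)
qed

lemma walk_block_end:
  assumes "p < q" "paired (x m) q" "\<And>l. p < l \<Longrightarrow> l < q \<Longrightarrow> \<not> paired (x m) l"
  shows "\<bar>walk x m (2 * q) - walk x m (2 * p)\<bar> = 2"
proof -
  obtain r where r: "q = Suc r" using assms by (cases q) auto
  have "walk x m (2 * r) = walk x m (2 * p)"
    by (rule walk_even_constant) (use assms r in auto)
  then show ?thesis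
    using r assms(2) sign[of "Suc (2 * r)" m] by (auto simp: paired_def)
qed

text \<open>A block ends at the first pair \<open>(2l-1, 2l)\<close> of equal signs, since every pair of
  opposite signs brings the walk back to its position at the start of the block.\<close>

lemma stop_time_Suc_eq:
  assumes "stop_time x m k = 2 * p" "p < q" "paired (x m) q"
    "\<And>l. p < l \<Longrightarrow> l < q \<Longrightarrow> \<not> paired (x m) l"
  shows "stop_time x m (Suc k) = 2 * q"
  unfolding stop_time.simps assms(1)
proof (rule Least_equality)
  show "2 * p < 2 * q \<and> \<bar>walk x m (2 * q) - walk x m (2 * p)\<bar> = 2"
    using walk_block_end[OF assms(2-4)] assms(2) by simp
  fix n assume "2 * p < n \<and> \<bar>walk x m n - walk x m (2 * p)\<bar> = 2"
  then show "2 * q \<le> n"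
    using walk_within_block[of p n q m] assms(4) by (force simp: not_le[symmetric])
qed

lemma next_pair:
  obtains q where "p < q" "paired (x m) q" "\<And>l. p < l \<Longrightarrow> l < q \<Longrightarrow> \<not> paired (x m) l"
proof -
  have "\<exists>q>p. paired (x m) q"
  proof (rule ccontr)
    \<comment> \<open>Without further pairs the count would stay constant after \<open>p\<close>,
      against \<open>pairs_unbounded\<close>.\<close>
    assume no: "\<not> (\<exists>q>p. paired (x m) q)"
    have "pair_count (x m) n \<le> pair_count (x m) p" for n
    proof (cases "p \<le> n")
      case True
      then show ?thesis by (induction n rule: dec_induct) (use no in auto)
    qed (simp add: pair_count_mono)
    then show False using pairs_unbounded[of "Suc (pair_count (x m) p)" m]
      by (meson Suc_n_not_le_n order_trans)
  qed
  then show ?thesis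
    using that LeastI_ex[of "\<lambda>q. q > p \<and> paired (x m) q"] not_less_Least[of _ "\<lambda>q. q > p \<and> paired (x m) q"]
    by blast
qed

lemma pair_count_between:
  assumes "p \<le> n" "n < q" "\<And>l. p < l \<Longrightarrow> l < q \<Longrightarrow> \<not> paired (x m) l"
  shows "pair_count (x m) n = pair_count (x m) p"
  using assms(1,2) by (induction n rule: dec_induct) (use assms in auto)

text \<open>Each block ends at the next equal pair, which raises the count by exactly one, so
  position and count are carried through the induction together.\<close>

lemma stop_time_even:
  "\<exists>p. stop_time x m k = 2 * p \<and> pair_count (x m) p = k"
proof (induction k)
  case 0
  then show ?case by (auto intro!: exI[of _ 0])
next
  case (Suc k)
  then obtain p where p: "stop_time x m k = 2 * p" "pair_count (x m) p = k" by auto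
  obtain q where q: "p < q" "paired (x m) q" "\<And>l. p < l \<Longrightarrow> l < q \<Longrightarrow> \<not> paired (x m) l"
    by (rule next_pair[of p m]) blast
  obtain r where r: "q = Suc r" using q by (cases q) auto
  have "pair_count (x m) r = pair_count (x m) p"
    by (rule pair_count_between) (use q r in auto)
  then have "pair_count (x m) q = Suc k" using r q p by simp
  with stop_time_Suc_eq[OF p(1) q] show ?case by auto
qed

lemma stop_time_block:
  obtains p q where "stop_time x m k = 2 * p" "stop_time x m (Suc k) = 2 * q" "p < q"
    "paired (x m) q" "\<And>l. p < l \<Longrightarrow> l < q \<Longrightarrow> \<not> paired (x m) l" "pair_count (x m) p = k"
proof -
  obtain p where p: "stop_time x m k = 2 * p" "pair_count (x m) p = k"
    using stop_time_even by blast
  obtain q where q: "p < q" "paired (x m) q" "\<And>l. p < l \<Longrightarrow> l < q \<Longrightarrow> \<not> paired (x m) l"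
    by (rule next_pair[of p m]) blast
  show ?thesis using that[OF p(1) stop_time_Suc_eq[OF p(1) q] q p(2)] .
qed

lemma stop_time_strict_mono: "strict_mono (stop_time x m)"
proof (rule strict_monoI_Suc)
  fix k
  obtain p q where "stop_time x m k = 2 * p" "stop_time x m (Suc k) = 2 * q" "p < q"
    by (rule stop_time_block[of m k])
  then show "stop_time x m k < stop_time x m (Suc k)" by linarith
qed

text \<open>Evaluates the \<open>THE\<close> in \<open>twisted\<close>: strict monotonicity of the
  stopping times makes the blocks disjoint.\<close>

lemma stop_time_index_unique:
  assumes "stop_time x m k < n" "n \<le> stop_time x m (Suc k)"
  shows "(THE k. stop_time x m k < n \<and> n \<le> stop_time x m (Suc k)) = k"
proof (rule the_equality)
  fix j assume j: "stop_time x m j < n \<and> n \<le> stop_time x m (Suc j)"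
  have "stop_time x m j < stop_time x m (Suc k)" "stop_time x m k < stop_time x m (Suc j)"
    using j assms by linarith+
  then have "j < Suc k" "k < Suc j"
    using strict_mono_less[OF stop_time_strict_mono] by auto
  then show "j = k" by simp
qed (use assms in simp)

text \<open>The decision to flip is taken once per block, so there the twisted walk follows the
  original one up to a fixed sign \<open>c\<close>. The original displacement is 2 or -2, so one of
  the two signs yields the displacement prescribed by level \<open>m\<close>.\<close>

lemma twisted_walk_block:
  obtains c where "c = 1 \<or> c = -1"
    "c * (walk x (Suc m) (stop_time x (Suc m) (Suc k)) - walk x (Suc m) (stop_time x (Suc m) k))
       = 2 * twisted x m (Suc k)"
    "\<And>n. stop_time x (Suc m) k \<le> n \<Longrightarrow> n \<le> stop_time x (Suc m) (Suc k) \<Longrightarrow>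
       twisted_walk x (Suc m) n - twisted_walk x (Suc m) (stop_time x (Suc m) k)
         = c * (walk x (Suc m) n - walk x (Suc m) (stop_time x (Suc m) k))"
proof -
  let ?S = "stop_time x (Suc m)" and ?w = "walk x (Suc m)"
  obtain p q where pq: "?S k = 2 * p" "?S (Suc k) = 2 * q" "p < q"
    "paired (x (Suc m)) q" "\<And>l. p < l \<Longrightarrow> l < q \<Longrightarrow> \<not> paired (x (Suc m)) l"
    by (rule stop_time_block[of "Suc m" k]) blast
  have two: "\<bar>?w (?S (Suc k)) - ?w (?S k)\<bar> = 2"
    unfolding pq(1,2) by (rule walk_block_end[OF pq(3-5)])
  define c :: real where "c = (if ?w (?S (Suc k)) - ?w (?S k) = 2 * twisted x m (Suc k) then 1 else -1)"
  have tw: "twisted x (Suc m) n = c * x (Suc m) n" if "?S k < n" "n \<le> ?S (Suc k)" for n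
    unfolding twisted.simps Let_def stop_time_index_unique[OF that] c_def by simp
  show ?thesis
  proof (rule that[of c])
    show "c * (?w (?S (Suc k)) - ?w (?S k)) = 2 * twisted x m (Suc k)"
      using two twisted_sign[of "Suc k" m] unfolding c_def by (auto simp: abs_if split: if_splits)
    fix n assume "?S k \<le> n" "n \<le> ?S (Suc k)"
    then show "twisted_walk x (Suc m) n - twisted_walk x (Suc m) (?S k) = c * (?w n - ?w (?S k))"
    proof (induction n rule: dec_induct)
      case (step n)
      then show ?case using tw[of "Suc n"] by (simp add: algebra_simps)
    qed simp
  qed (simp add: c_def)
qed

text \<open>Block displacements telescope: block \<open>k\<close> adds twice the step
  \<open>Suc k\<close> of the coarser walk.\<close>

lemma twisted_walk_stop_time: "twisted_walk x (Suc m) (stop_time x (Suc m) k) = 2 * twisted_walk x m k"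
proof (induction k)
  case (Suc k)
  obtain c where c: "c * (walk x (Suc m) (stop_time x (Suc m) (Suc k)) - walk x (Suc m) (stop_time x (Suc m) k))
       = 2 * twisted x m (Suc k)"
    "\<And>n. stop_time x (Suc m) k \<le> n \<Longrightarrow> n \<le> stop_time x (Suc m) (Suc k) \<Longrightarrow>
       twisted_walk x (Suc m) n - twisted_walk x (Suc m) (stop_time x (Suc m) k)
         = c * (walk x (Suc m) n - walk x (Suc m) (stop_time x (Suc m) k))"
    by (rule twisted_walk_block[of m k]) blast
  have "stop_time x (Suc m) k \<le> stop_time x (Suc m) (Suc k)"
    by (intro strict_mono_leD[OF stop_time_strict_mono]) simp
  from c(2)[OF this order_refl] c(1) Suc show ?case
    by simp
qed simp

text \<open>The count at \<open>n div 2\<close> is the number \<open>k\<close> of blocks completed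
  by time \<open>n\<close>. Hence \<open>n\<close> lies in the block starting at stopping time
  \<open>k\<close>, where the fine walk is twice the coarse walk at \<open>k\<close>, and inside a
  block it moves by at most 1 from that value.\<close>

lemma twisted_walk_refine:
  "\<bar>twisted_walk x (Suc m) n - 2 * twisted_walk x m (pair_count (x (Suc m)) (n div 2))\<bar> \<le> 1"
proof -
  define k where "k = pair_count (x (Suc m)) (n div 2)"
  obtain p q where pq: "stop_time x (Suc m) k = 2 * p" "stop_time x (Suc m) (Suc k) = 2 * q" "p < q"
    "paired (x (Suc m)) q" "\<And>l. p < l \<Longrightarrow> l < q \<Longrightarrow> \<not> paired (x (Suc m)) l"
    "pair_count (x (Suc m)) p = k"
    by (rule stop_time_block[of "Suc m" k]) blast
  obtain r where r: "q = Suc r" using pq by (cases q) auto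
  \<comment> \<open>Either \<open>k = 0\<close> and \<open>p = 0\<close>, or \<open>p\<close> is
    itself an equal pair, so that stopping before \<open>p\<close> would give a count below
    \<open>k\<close>.\<close>
  have "p \<le> n div 2"
  proof (rule ccontr)
    assume "\<not> p \<le> n div 2"
    then obtain s where s: "p = Suc s" "n div 2 \<le> s" by (cases p) auto
    have "paired (x (Suc m)) p"
    proof (cases k)
      case 0
      then have "p = 0" using pq(1) by simp
      then show ?thesis using s by simp
    next
      case (Suc j)
      obtain p' q' where "stop_time x (Suc m) (Suc j) = 2 * q'" "paired (x (Suc m)) q'"
        by (rule stop_time_block[of "Suc m" j]) blast
      then show ?thesis using Suc pq(1) by simp
    qed
    then have "pair_count (x (Suc m)) s < k" using pq s by auto
    then show False using pair_count_mono[OF s(2), of "x (Suc m)"] by (simp add: k_def)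
  qed
  \<comment> \<open>At \<open>q\<close>, the next equal pair, the count is already
    \<open>Suc k\<close>.\<close>
  moreover have "n div 2 < q"
  proof (rule ccontr)
    assume "\<not> n div 2 < q"
    then have "pair_count (x (Suc m)) q \<le> k" unfolding k_def by (intro pair_count_mono) simp
    moreover have "pair_count (x (Suc m)) r = k"
      using pair_count_between[of p r q "Suc m"] pq r by auto
    ultimately show False using r pq(4) by simp
  qed
  ultimately have n: "2 * p \<le> n" "n < 2 * q" by auto
  obtain c where c: "c = 1 \<or> c = -1"
    "\<And>n. stop_time x (Suc m) k \<le> n \<Longrightarrow> n \<le> stop_time x (Suc m) (Suc k) \<Longrightarrow>
       twisted_walk x (Suc m) n - twisted_walk x (Suc m) (stop_time x (Suc m) k)
         = c * (walk x (Suc m) n - walk x (Suc m) (stop_time x (Suc m) k))"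
    by (rule twisted_walk_block[of m k]) blast
  have "twisted_walk x (Suc m) n - 2 * twisted_walk x m k = c * (walk x (Suc m) n - walk x (Suc m) (2 * p))"
    using c(2)[of n] n pq(1,2) twisted_walk_stop_time[of m k] by simp
  moreover have "\<bar>walk x (Suc m) n - walk x (Suc m) (2 * p)\<bar> \<le> 1"
    using walk_within_block n pq by blast
  ultimately show ?thesis using c(1) unfolding k_def by auto
qed

end

subsection \<open>Modulus of continuity and convergence rate\<close>

definition rate :: "nat \<Rightarrow> real" where
  "rate m = real m powr (3 / 4) * 2 powr (- real m / 2)"

lemma rate_nonneg: "rate m \<ge> 0"
  by (simp add: rate_def)

text \<open>The factor splits as \<open>11/10 * 8/11\<close>, where \<open>8/11\<close> exceeds
  \<open>1 / sqrt 2\<close>. A factor below 1 makes the differences of consecutive levels sum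
  geometrically.\<close>

lemma rate_contracts: "\<forall>\<^sub>F m in sequentially. rate (Suc m) \<le> 4/5 * rate m"
proof -
  have "\<forall>\<^sub>F m in sequentially. (real m + 1) powr (3/4) \<le> 11/10 * real m powr (3/4)"
    by real_asymp
  then show ?thesis
  proof eventually_elim
    case (elim m)
    have "(2::real) powr (- real (Suc m) / 2) = 2 powr (- real m / 2) * 2 powr (- (1/2))"
      by (simp add: field_simps flip: powr_add)
    moreover have "(2::real) powr (- (1/2)) \<le> 8/11"
    proof -
      have "11/8 \<le> sqrt (2::real)" by (rule real_le_rsqrt) (simp add: power2_eq_square)
      then show ?thesis by (simp add: powr_minus powr_half_sqrt field_simps)
    qed
    ultimately have "(2::real) powr (- real (Suc m) / 2) \<le> 8/11 * 2 powr (- real m / 2)"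
      by simp
    then have "(real m + 1) powr (3/4) * 2 powr (- real (Suc m) / 2)
        \<le> (11/10 * real m powr (3/4)) * (8/11 * 2 powr (- real m / 2))"
      by (intro mult_mono elim) auto
    then show ?case by (simp add: rate_def add.commute)
  qed
qed

lemma inverse_power_le_rate: "\<forall>\<^sub>F m in sequentially. 1 / 2 ^ m \<le> rate m"
  unfolding rate_def by real_asymp

text \<open>The left side will bound \<open>pair_count\<close> on the time range of level
  \<open>Suc r\<close>, so the time change maps this range into that of level \<open>r\<close>.
  Going down one level, the slack \<open>1 / (r + 1)\<close> leaves room
  \<open>4 ^ r / ((r + 1) * (r + 2))\<close>, which outgrows the fluctuation of order
  \<open>sqrt r * 2 ^ r\<close>.\<close>

lemma eventually_window_range_step:
  fixes K :: real
  assumes "K > 0"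
  shows "\<forall>\<^sub>F r in sequentially. (K + 1 / (real (Suc r) + 1)) * 4 ^ Suc r / 4 + 1 / 4
      + 2 * sqrt (real (Suc r) * ((K + 1 / (real (Suc r) + 1)) * 4 ^ Suc r)) \<le> (K + 1 / (real r + 1)) * 4 ^ r"
proof -
  define C where "C = sqrt (K + 1)"
  have "C > 0" using assms by (simp add: C_def)
  then have "\<forall>\<^sub>F r in sequentially. 1 / 4 + 4 * C * sqrt (real r + 1) * 2 ^ r \<le> 4 ^ r / ((real r + 1) * (real r + 2))"
    by real_asymp
  then show ?thesis
  proof eventually_elim
    case (elim r)
    have "sqrt (real (Suc r) * ((K + 1 / (real (Suc r) + 1)) * 4 ^ Suc r))
        \<le> sqrt (real (Suc r) * ((K + 1) * 4 ^ Suc r))"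
      by (intro real_sqrt_le_mono mult_left_mono mult_right_mono add_left_mono) auto
    also have "\<dots> = 2 * C * sqrt (real r + 1) * 2 ^ r"
      by (simp add: real_sqrt_mult C_def real_sqrt_power add.commute)
    finally have "2 * sqrt (real (Suc r) * ((K + 1 / (real (Suc r) + 1)) * 4 ^ Suc r))
        \<le> 4 * C * sqrt (real r + 1) * 2 ^ r" by simp
    moreover have "(K + 1 / (real r + 1)) * 4 ^ r
        = (K + 1 / (real (Suc r) + 1)) * 4 ^ Suc r / 4 + 4 ^ r / ((real r + 1) * (real r + 2))"
      by (simp add: divide_simps) (simp add: algebra_simps)
    ultimately show ?case using elim by linarith
  qed
qed

lemma eventually_window_range_le:
  fixes K :: real
  assumes "K > 0"
  shows "\<forall>\<^sub>F r in sequentially. (K + 1 / (real r + 1)) * 4 ^ r \<le> 8 ^ r"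
  using assms by real_asymp

text \<open>Makes windows of the size of the time distortion, of order
  \<open>sqrt m * 2 ^ m\<close>, long enough for the modulus of continuity.\<close>

lemma eventually_linear_le_sqrt_power: "\<forall>\<^sub>F m in sequentially. 576 * real m \<le> 2 * sqrt (real m) * 2 ^ m"
  by real_asymp

lemma lin_interp_near:
  assumes "\<And>k. \<bar>f (Suc k) - f k\<bar> \<le> 1" "s \<ge> 0"
  shows "\<bar>lin_interp f s - f (nat \<lfloor>s\<rfloor>)\<bar> \<le> 1"
proof -
  define k where "k = nat \<lfloor>s\<rfloor>"
  have "0 \<le> s - real k" "s - real k \<le> 1" unfolding k_def using assms(2) by linarith+
  moreover have "\<bar>f (Suc k) - f k\<bar> \<le> 1" by (rule assms)
  ultimately have "\<bar>s - real k\<bar> * \<bar>f (Suc k) - f k\<bar> \<le> 1 * 1"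
    by (intro mult_mono) auto
  then show ?thesis
    by (simp add: lin_interp_def Let_def k_def abs_mult)
qed

context sign_array
begin

lemma twist_shrink_near_grid:
  assumes "t \<ge> 0"
  shows "\<bar>2 ^ m * twist_shrink x m t - twisted_walk x m (nat \<lfloor>t * 4 ^ m\<rfloor>)\<bar> \<le> 1"
proof -
  have "\<bar>twisted_walk x m (Suc k) - twisted_walk x m k\<bar> \<le> 1" for k
    using twisted_walk_increment_le[of k "Suc k" m] by simp
  from lin_interp_near[of "twisted_walk x m", OF this, of "t * 4 ^ m"] show ?thesis
    using assms by (simp add: twist_shrink_def power_mult)
qed

end

text \<open>The level \<open>r0\<close> depends on the outcome and comes from
  Borel-Cantelli.\<close>

locale concentrated_sign_array = sign_array +
  fixes r0 :: nat
  assumes concentrated: "\<And>r b a. r \<ge> r0 \<Longrightarrow> b \<le> 8 ^ r \<Longrightarrow> a \<le> b \<Longrightarrow>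
    \<bar>\<Sum>l\<in>{a<..b}. x r (2 * l - 1) * x r (2 * l)\<bar> \<le> 4 * sqrt (real r * (real b - real a))"
begin

text \<open>About half as many pairs as steps, and half of these pairs equal. Rounding changes the
  number of pairs by at most 1/2 and the count by \<open>1 / 4\<close>; the root term is half the
  concentration bound.\<close>

lemma pair_count_window:
  assumes "r \<ge> r0" "b \<le> 8 ^ r" "a \<le> b"
  shows "\<bar>real (pair_count (x r) (b div 2)) - real (pair_count (x r) (a div 2)) - (real b - real a) / 4\<bar>
    \<le> 1 / 4 + 2 * sqrt (real r * (real b - real a))"
proof -
  define M where "M = real (b div 2) - real (a div 2)"
  have ab: "a div 2 \<le> b div 2" using assms by (simp add: div_le_mono)
  have "\<bar>\<Sum>l\<in>{a div 2<..b div 2}. x r (2 * l - 1) * x r (2 * l)\<bar> \<le> 4 * sqrt (real r * M)"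
    unfolding M_def by (rule concentrated[OF assms(1) _ ab]) (use assms in linarith)
  moreover have "M \<le> real b - real a"
  proof -
    have "b div 2 + a \<le> b + a div 2" using assms(3) by presburger
    then show ?thesis unfolding M_def by linarith
  qed
  then have "sqrt (real r * M) \<le> sqrt (real r * (real b - real a))"
    by (intro real_sqrt_le_mono mult_left_mono) auto
  moreover have "\<bar>M / 2 - (real b - real a) / 4\<bar> \<le> 1 / 4"
  proof -
    have half: "2 * real (n div 2) \<le> real n" "real n \<le> 2 * real (n div 2) + 1" for n :: nat
      by linarith+
    define p q where "p = real (a div 2)" and "q = real (b div 2)"
    show ?thesis using half[of a] half[of b] unfolding M_def p_def[symmetric] q_def[symmetric]
      by (simp add: abs_le_iff field_simps)
  qed
  ultimately show ?thesis
    using pair_count_diff[of "x r", OF sign ab] unfolding M_def[symmetric] by linarith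
qed

text \<open>Passing from level \<open>r + 1\<close> to level \<open>r\<close>, a window of length \<open>L\<close> turns into one of length at
  most \<open>(sqrt L / 2 + 3 * sqrt (r + 1))\<^sup>2\<close>, while increments are halved. The negative term \<open>- (12 * A + 1) * r\<close>
  absorbs the error of each step; on windows with \<open>L \<le> 4 * 576 * r\<close> the trivial bound \<open>L\<close> suffices.\<close>

lemma twisted_walk_modulus_aux:
  fixes R :: "nat \<Rightarrow> real"
  assumes r1: "r1 \<ge> r0" "r1 \<ge> 4"
    and R8: "\<And>r. r \<ge> r1 \<Longrightarrow> R r \<le> 8 ^ r"
    and Rstep: "\<And>r. r \<ge> r1 \<Longrightarrow> R (Suc r) / 4 + 1 / 4 + 2 * sqrt (real (Suc r) * R (Suc r)) \<le> R r"
    and A: "A \<ge> 97" "A \<ge> R r1"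
    and "r \<ge> r1" "a \<le> b" "real b \<le> R r" "real b - real a \<le> L" "576 * real r \<le> L"
  shows "\<bar>twisted_walk x r b - twisted_walk x r a\<bar> \<le> A * sqrt (real r * L) - (12 * A + 1) * real r"
  using \<open>r \<ge> r1\<close> assms(8-)
proof (induction r arbitrary: a b L rule: dec_induct)
  \<comment> \<open>With \<open>u = sqrt L\<close> and \<open>v = sqrt r\<close>, here
    \<open>24 * v \<le> u \<le> 48 * v\<close>. The trivial bound \<open>u * u\<close> is at most
    \<open>48 * v * u\<close>, and the remaining \<open>(A - 48) * v * u\<close> pays for the
    negative term if \<open>12 * A + 1 \<le> 24 * A - 1152\<close>, whence
    \<open>A \<ge> 97\<close>.\<close>
  have small: "\<bar>twisted_walk x r b - twisted_walk x r a\<bar> \<le> A * sqrt (real r * L) - (12 * A + 1) * real r"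
    if "a \<le> b" "real b - real a \<le> L" "576 * real r \<le> L" "L \<le> 2304 * real r" for r a b L
  proof -
    define u v where "u = sqrt L" and "v = sqrt (real r)"
    have uv: "u \<ge> 0" "v \<ge> 0" "L = u * u" "real r = v * v"
      using that by (auto simp: u_def v_def)
    have u1: "24 * v \<le> u" unfolding u_def v_def
      by (rule real_le_rsqrt) (use that in \<open>simp add: power_mult_distrib\<close>)
    have "u \<le> 48 * v" unfolding u_def v_def
      by (rule real_le_lsqrt) (use that in \<open>auto simp: power_mult_distrib\<close>)
    then have "u * u \<le> 48 * v * u" using uv by (intro mult_right_mono) auto
    moreover have "(A - 48) * v * (24 * v) \<le> (A - 48) * v * u"
      using uv u1 A by (intro mult_left_mono) auto
    moreover have "(12 * A + 1) * (v * v) \<le> (24 * A - 1152) * (v * v)"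
      using A by (intro mult_right_mono) auto
    ultimately have "u * u \<le> A * (v * u) - (12 * A + 1) * (v * v)"
      by (simp add: algebra_simps)
    moreover have "\<bar>twisted_walk x r b - twisted_walk x r a\<bar> \<le> u * u"
      using twisted_walk_increment_le[OF \<open>a \<le> b\<close>, of r] that unfolding uv(3) by linarith
    moreover have eq: "sqrt (real r * L) = v * u"
      by (simp add: real_sqrt_mult u_def v_def)
    ultimately show ?thesis
      unfolding eq uv(4)[symmetric] by linarith
  qed
  {
    case base
    show ?case
    proof (cases "L \<le> 2304 * real r1")
      \<comment> \<open>On a long window at the lowest level, \<open>48 * v \<le> u\<close> makes
        the claimed bound at least \<open>36 * A - 1\<close>, hence at least \<open>A\<close>, which
        already exceeds the whole range \<open>R r1\<close>.\<close>
      case False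
      define u v where "u = sqrt L" and "v = sqrt (real r1)"
      have uv: "u \<ge> 0" "v \<ge> 0" "real r1 = v * v"
        using False by (auto simp: u_def v_def)
      have "48 * v \<le> u" unfolding u_def v_def
        by (rule real_le_rsqrt) (use False in \<open>simp add: power_mult_distrib\<close>)
      then have "(A * v) * (48 * v) \<le> (A * v) * u"
        using uv A by (intro mult_left_mono) auto
      then have "48 * (A * (v * v)) \<le> A * (v * u)" by (simp only: ac_simps)
      moreover have "(36 * A - 1) * 1 \<le> (36 * A - 1) * (v * v)"
        using A r1 uv(3)[symmetric] by (intro mult_left_mono) auto
      then have "36 * A - 1 \<le> 36 * (A * (v * v)) - v * v" by (simp add: algebra_simps)
      moreover have "(12 * A + 1) * (v * v) = 12 * (A * (v * v)) + v * v" by (simp add: algebra_simps)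
      ultimately have "A \<le> A * (v * u) - (12 * A + 1) * (v * v)"
        using A by linarith
      moreover have "\<bar>twisted_walk x r1 b - twisted_walk x r1 a\<bar> \<le> A"
        using twisted_walk_increment_le[of a b r1] base A by linarith
      moreover have eq: "sqrt (real r1 * L) = v * u"
        by (simp add: real_sqrt_mult u_def v_def)
      ultimately show ?thesis
        unfolding eq uv(3)[symmetric] by linarith
    qed (use small base in auto)
  next
    case (step r)
    show ?case
    proof (cases "L \<le> 2304 * real (Suc r)")
      case False
      define u v where "u = sqrt L" and "v = sqrt (real (Suc r))"
      have uv: "u \<ge> 0" "v \<ge> 0" "L = u * u" "real (Suc r) = v * v"
        using False by (auto simp: u_def v_def)
      have "48 * v \<le> u" unfolding u_def v_def
        by (rule real_le_rsqrt) (use False in \<open>simp add: power_mult_distrib\<close>)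
      have v1: "1 \<le> v" unfolding v_def by simp
      have "1 * 1 \<le> u * v"
        using v1 \<open>48 * v \<le> u\<close> by (intro mult_mono) auto
      \<comment> \<open>Expanded, \<open>L'\<close> is
        \<open>L / 4 + 3 * (u * v) + 9 * (v * v)\<close>, which covers the image window
        \<open>L / 4 + 1 / 4 + 2 * (u * v)\<close>. As a square it has an explicit root for the
        induction hypothesis.\<close>
      define a' b' L' where "a' = pair_count (x (Suc r)) (a div 2)"
        and "b' = pair_count (x (Suc r)) (b div 2)" and "L' = (u / 2 + 3 * v)\<^sup>2"
      have "real b \<le> real (8 ^ Suc r)"
        using R8[of "Suc r"] step by simp
      then have b8: "b \<le> 8 ^ Suc r" by linarith
      have "r0 \<le> Suc r" using r1 step by simp
      note window = pair_count_window[OF this]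
      have "sqrt (real (Suc r) * (real b - real a)) \<le> sqrt (real (Suc r) * L)"
        using step by (intro real_sqrt_le_mono mult_left_mono) auto
      also have "\<dots> = u * v" by (simp add: real_sqrt_mult u_def v_def)
      finally have "real b' - real a' \<le> L / 4 + 1 / 4 + 2 * (u * v)"
        using window[OF b8 \<open>a \<le> b\<close>] \<open>real b - real a \<le> L\<close>
        unfolding a'_def[symmetric] b'_def[symmetric] abs_le_iff diff_divide_distrib by linarith
      also have "\<dots> \<le> L'"
        unfolding L'_def using uv \<open>1 * 1 \<le> u * v\<close> by (simp add: power2_eq_square algebra_simps)
      finally have L': "real b' - real a' \<le> L'" .
      have "a' \<le> b'"
        unfolding a'_def b'_def using step by (intro pair_count_mono div_le_mono) auto
      \<comment> \<open>The window from 0 to \<open>b\<close> keeps the image point inside the range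
        of level \<open>r\<close>.\<close>
      have "sqrt (real (Suc r) * real b) \<le> sqrt (real (Suc r) * R (Suc r))"
        using step by (intro real_sqrt_le_mono mult_left_mono) auto
      moreover have "\<bar>real b' - real b / 4\<bar> \<le> 1 / 4 + 2 * sqrt (real (Suc r) * real b)"
        using window[OF b8, of 0] unfolding b'_def by simp
      ultimately have "real b' \<le> R r"
        using Rstep[OF step.hyps(1)] \<open>real b \<le> R (Suc r)\<close> unfolding abs_le_iff by linarith
      have "576 * real r \<le> L / 4" using False by simp
      also have "\<dots> \<le> L'"
        unfolding L'_def using uv by (simp add: power2_eq_square algebra_simps)
      finally have "\<bar>twisted_walk x r b' - twisted_walk x r a'\<bar>
          \<le> A * sqrt (real r * L') - (12 * A + 1) * real r"
        by (rule step.IH[OF \<open>a' \<le> b'\<close> \<open>real b' \<le> R r\<close> L'])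
      also have "sqrt (real r * L') \<le> v * (u / 2 + 3 * v)"
      proof -
        have "sqrt (real r * L') \<le> sqrt (real (Suc r) * L')"
          by (intro real_sqrt_le_mono mult_right_mono) (auto simp: L'_def)
        also have "\<dots> = v * (u / 2 + 3 * v)"
          using uv(1,2) unfolding real_sqrt_mult L'_def v_def[symmetric] by simp
        finally show ?thesis .
      qed
      finally have "\<bar>twisted_walk x r b' - twisted_walk x r a'\<bar>
          \<le> A * (v * (u / 2 + 3 * v)) - (12 * A + 1) * real r"
        using A by simp
      moreover define X where "X = A * (v * (u / 2 + 3 * v)) - (12 * A + 1) * (v * v - 1)"
      ultimately have "\<bar>twisted_walk x r b' - twisted_walk x r a'\<bar> \<le> X"
        unfolding uv(4)[symmetric] by simp
      moreover have "\<bar>twisted_walk x (Suc r) b - 2 * twisted_walk x r b'\<bar> \<le> 1"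
        "\<bar>twisted_walk x (Suc r) a - 2 * twisted_walk x r a'\<bar> \<le> 1"
        unfolding a'_def b'_def by (rule twisted_walk_refine)+
      ultimately have "\<bar>twisted_walk x (Suc r) b - twisted_walk x (Suc r) a\<bar>
          \<le> 2 * X + 2"
        by linarith
      \<comment> \<open>Expanding \<open>2 * X + 2\<close> leaves the constant
        \<open>24 * A + 4\<close>, to be absorbed by the spare \<open>(6 * A + 1) * (v * v)\<close>.
        This uses \<open>r1 \<ge> 4\<close>.\<close>
      moreover have "(6 * A + 1) * 4 \<le> (6 * A + 1) * (v * v)"
        using A r1 step uv(4) by (intro mult_left_mono) auto
      ultimately have "\<bar>twisted_walk x (Suc r) b - twisted_walk x (Suc r) a\<bar>
          \<le> A * (v * u) - (12 * A + 1) * (v * v)"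
        unfolding X_def by (simp add: algebra_simps)
      moreover have eq: "sqrt (real (Suc r) * L) = v * u"
        unfolding real_sqrt_mult u_def v_def ..
      ultimately show ?thesis
        unfolding eq uv(4)[symmetric] by linarith
    next
      case True
      then show ?thesis using step.prems by (intro small) auto
    qed
  }
qed

text \<open>Applies the induction to the ranges \<open>(K + 1 / (r + 1)) * 4 ^ r\<close>, with
  \<open>A\<close> large enough for the range of the lowest level. The last conclusion lets
  consecutive levels be compared within these ranges.\<close>

lemma twisted_walk_modulus:
  fixes K :: real
  assumes "K > 0"
  obtains A r1 where "A \<ge> 0" "r1 \<ge> r0"
    "\<And>r a b L. r \<ge> r1 \<Longrightarrow> real a \<le> (K + 1 / (real r + 1)) * 4 ^ r \<Longrightarrow> real b \<le> (K + 1 / (real r + 1)) * 4 ^ r \<Longrightarrow>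
       \<bar>real b - real a\<bar> \<le> L \<Longrightarrow> 576 * real r \<le> L \<Longrightarrow>
       \<bar>twisted_walk x r b - twisted_walk x r a\<bar> \<le> A * sqrt (real r * L)"
    "\<And>r b. r \<ge> r1 \<Longrightarrow> real b \<le> (K + 1 / (real (Suc r) + 1)) * 4 ^ Suc r \<Longrightarrow>
       b \<le> 8 ^ Suc r \<and> real (pair_count (x (Suc r)) (b div 2)) \<le> (K + 1 / (real r + 1)) * 4 ^ r"
proof -
  define R where "R r = (K + 1 / (real r + 1)) * 4 ^ r" for r
  have "\<forall>\<^sub>F r in sequentially. R (Suc r) / 4 + 1 / 4 + 2 * sqrt (real (Suc r) * R (Suc r)) \<le> R r \<and> R r \<le> 8 ^ r"
    unfolding R_def using eventually_window_range_step[OF assms] eventually_window_range_le[OF assms] by (rule eventually_conj)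
  then obtain N where N: "\<And>r. r \<ge> N \<Longrightarrow> R (Suc r) / 4 + 1 / 4 + 2 * sqrt (real (Suc r) * R (Suc r)) \<le> R r"
    "\<And>r. r \<ge> N \<Longrightarrow> R r \<le> 8 ^ r"
    by (auto simp: eventually_sequentially)
  define r1 where "r1 = max (max N r0) 4"
  have r1: "r1 \<ge> N" "r1 \<ge> r0" "r1 \<ge> 4" by (auto simp: r1_def)
  define A where "A = max 97 (R r1)"
  have A: "A \<ge> 97" "A \<ge> R r1" by (auto simp: A_def)
  have le: "\<bar>twisted_walk x r b - twisted_walk x r a\<bar> \<le> A * sqrt (real r * L)"
    if "r \<ge> r1" "a \<le> b" "real b \<le> R r" "real b - real a \<le> L" "576 * real r \<le> L" for r a b L
  proof -
    have "\<bar>twisted_walk x r b - twisted_walk x r a\<bar> \<le> A * sqrt (real r * L) - (12 * A + 1) * real r"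
      by (rule twisted_walk_modulus_aux[where R = R and ?r1.0 = r1]) (use N r1 A that in auto)
    moreover have "0 \<le> (12 * A + 1) * real r" using A by simp
    ultimately show ?thesis by linarith
  qed
  show ?thesis
  proof (rule that[of A r1, folded R_def])
    show "\<bar>twisted_walk x r b - twisted_walk x r a\<bar> \<le> A * sqrt (real r * L)"
      if "r \<ge> r1" "real a \<le> R r" "real b \<le> R r" "\<bar>real b - real a\<bar> \<le> L" "576 * real r \<le> L" for r a b L
      using le[of r a b L] le[of r b a L] that by (cases "a \<le> b") (auto simp: abs_minus_commute)
    fix r b assume rb: "r \<ge> r1" "real b \<le> R (Suc r)"
    then have "real b \<le> real (8 ^ Suc r)" using N(2)[of "Suc r"] r1 by simp
    then have b8: "b \<le> 8 ^ Suc r" by linarith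
    have "sqrt (real (Suc r) * real b) \<le> sqrt (real (Suc r) * R (Suc r))"
      using rb by (intro real_sqrt_le_mono mult_left_mono) auto
    moreover have "\<bar>real (pair_count (x (Suc r)) (b div 2)) - real b / 4\<bar> \<le> 1 / 4 + 2 * sqrt (real (Suc r) * real b)"
      using pair_count_window[of "Suc r" b 0] b8 rb r1 by simp
    ultimately have "real (pair_count (x (Suc r)) (b div 2)) \<le> R r"
      using N(1)[of r] rb r1 unfolding abs_le_iff by linarith
    with b8 show "b \<le> 8 ^ Suc r \<and> real (pair_count (x (Suc r)) (b div 2)) \<le> R r" ..
  qed (use A r1 in auto)
qed

text \<open>At time \<open>t\<close> the fine walk at \<open>n\<close> is close to twice the coarse
  walk at \<open>j\<close>, whereas the coarse level itself stands at \<open>k\<close>. Since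
  \<open>j - k\<close> is of order \<open>sqrt m * 2 ^ m\<close>, the modulus gives
  \<open>m powr (3/4) * 2 powr (m / 2)\<close>, and scaling by \<open>2 ^ m\<close> gives the
  rate.\<close>

lemma twist_shrink_consecutive:
  fixes K :: real
  assumes "K > 0"
  obtains D m1 where "D \<ge> 0"
    "\<And>m t. m \<ge> m1 \<Longrightarrow> 0 \<le> t \<Longrightarrow> t \<le> K \<Longrightarrow> \<bar>twist_shrink x (Suc m) t - twist_shrink x m t\<bar> \<le> D * rate m"
proof -
  obtain A r1 where A: "A \<ge> 0" "r1 \<ge> r0"
    "\<And>r a b L. r \<ge> r1 \<Longrightarrow> real a \<le> (K + 1 / (real r + 1)) * 4 ^ r \<Longrightarrow> real b \<le> (K + 1 / (real r + 1)) * 4 ^ r \<Longrightarrow>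
       \<bar>real b - real a\<bar> \<le> L \<Longrightarrow> 576 * real r \<le> L \<Longrightarrow>
       \<bar>twisted_walk x r b - twisted_walk x r a\<bar> \<le> A * sqrt (real r * L)"
    "\<And>r b. r \<ge> r1 \<Longrightarrow> real b \<le> (K + 1 / (real (Suc r) + 1)) * 4 ^ Suc r \<Longrightarrow>
       b \<le> 8 ^ Suc r \<and> real (pair_count (x (Suc r)) (b div 2)) \<le> (K + 1 / (real r + 1)) * 4 ^ r"
    using twisted_walk_modulus[OF assms] by blast
  have "\<forall>\<^sub>F m in sequentially. 576 * real m \<le> 2 * sqrt (real m) * 2 ^ m \<and> 1 / 2 ^ m \<le> rate m \<and> m \<ge> 1 \<and> m \<ge> r1"
    by (intro eventually_conj eventually_linear_le_sqrt_power inverse_power_le_rate eventually_ge_at_top)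
  then obtain m1 where m1: "\<And>m. m \<ge> m1 \<Longrightarrow> 576 * real m \<le> 2 * sqrt (real m) * 2 ^ m"
    "\<And>m. m \<ge> m1 \<Longrightarrow> 1 / 2 ^ m \<le> rate m" "\<And>m. m \<ge> m1 \<Longrightarrow> m \<ge> 1" "\<And>m. m \<ge> m1 \<Longrightarrow> m \<ge> r1"
    by (auto simp: eventually_sequentially)
  \<comment> \<open>With \<open>s = sqrt m * 2 ^ m\<close>, the fluctuation contributes
    \<open>8 * sqrt K * s\<close> to the distance of \<open>j\<close> and \<open>k\<close>, and 2
    covers the rounding; \<open>s \<ge> 1\<close> merges both into \<open>E * s\<close>.\<close>
  define E where "E = 2 + 8 * sqrt K"
  have E: "E \<ge> 2" using assms by (simp add: E_def)
  show ?thesis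
  proof (rule that[of "A * sqrt E + 2" m1])
    fix m t assume m: "m \<ge> m1" and t: "0 \<le> t" "t \<le> K"
    have m': "m \<ge> 1" "m \<ge> r1" using m1(3,4) m by auto
    define k n where "k = nat \<lfloor>t * 4 ^ m\<rfloor>" and "n = nat \<lfloor>t * 4 ^ Suc m\<rfloor>"
    define j where "j = pair_count (x (Suc m)) (n div 2)"
    have kt: "real k \<le> t * 4 ^ m" "t * 4 ^ m < real k + 1"
      unfolding k_def using t by (simp, linarith?)+
    have nt: "real n \<le> t * 4 ^ Suc m" "t * 4 ^ Suc m < real n + 1"
      unfolding n_def using t by (simp, linarith?)+
    have "t * 4 ^ Suc m \<le> K * 4 ^ Suc m" "t * 4 ^ m \<le> K * 4 ^ m" using t by auto
    moreover have "K * 4 ^ i \<le> (K + 1 / (real i + 1)) * 4 ^ i" for i by (intro mult_right_mono) auto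
    ultimately have kR: "real k \<le> (K + 1 / (real m + 1)) * 4 ^ m"
      and nK: "real n \<le> K * 4 ^ Suc m"
      and nR: "real n \<le> (K + 1 / (real (Suc m) + 1)) * 4 ^ Suc m"
      using kt nt by (meson order_trans)+
    from A(4)[OF m'(2) nR] have n8: "n \<le> 8 ^ Suc m" and jR: "real j \<le> (K + 1 / (real m + 1)) * 4 ^ m"
      unfolding j_def by auto
    define s where "s = sqrt (real m) * 2 ^ m"
    have "s \<ge> 1 * 1" unfolding s_def using m' by (intro mult_mono) auto
    have "\<bar>real j - real n / 4\<bar> \<le> 1 / 4 + 2 * sqrt (real (Suc m) * real n)"
      using pair_count_window[of "Suc m" n 0] n8 m' A(2) unfolding j_def by simp
    moreover have "sqrt (real (Suc m) * real n) \<le> sqrt (4 * real m * (K * 4 ^ Suc m))"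
      using nK m' by (intro real_sqrt_le_mono mult_mono) auto
    moreover have "sqrt (4 * real m * (K * 4 ^ Suc m)) = 4 * sqrt K * s"
      by (simp add: real_sqrt_mult real_sqrt_power s_def)
    moreover have "\<bar>real n / 4 - real k\<bar> \<le> 1" using kt nt by (simp add: abs_le_iff)
    ultimately have "\<bar>real j - real k\<bar> \<le> 2 + 8 * sqrt K * s"
      unfolding abs_le_iff by linarith
    also have "\<dots> \<le> E * s" using \<open>s \<ge> 1 * 1\<close> by (simp add: E_def algebra_simps)
    finally have jk: "\<bar>real j - real k\<bar> \<le> E * s" .
    have "576 * real m \<le> E * s"
      using m1(1)[OF m] E mult_right_mono[of 2 E s] \<open>s \<ge> 1 * 1\<close> unfolding s_def by linarith
    with A(3)[OF m'(2) kR jR jk] have "\<bar>twisted_walk x m j - twisted_walk x m k\<bar> \<le> A * sqrt (real m * (E * s))" .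
    also have "sqrt (real m * (E * s)) = sqrt E * (2 ^ m * rate m)"
    proof -
      have "sqrt (real m * (E * s)) = sqrt E * sqrt (real m * s)" by (simp add: real_sqrt_mult)
      also have "real m * s = (real m powr (3/4) * 2 powr (real m / 2))\<^sup>2"
      proof -
        have "(real m powr (3/4))\<^sup>2 = real m powr 1 * real m powr (1/2)"
          unfolding power2_eq_square powr_add[symmetric] by simp
        moreover have "(2 powr (real m / 2))\<^sup>2 = (2::real) ^ m"
          unfolding power2_eq_square by (simp add: powr_realpow flip: powr_add)
        ultimately show ?thesis
          by (simp add: s_def power_mult_distrib powr_half_sqrt)
      qed
      also have "sqrt \<dots> = real m powr (3/4) * 2 powr (real m / 2)" by simp
      also have "2 powr (real m / 2) = 2 ^ m * 2 powr (- real m / 2)"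
        by (simp add: powr_realpow[symmetric] flip: powr_add)
      finally show ?thesis by (simp add: rate_def)
    qed
    finally have "\<bar>twisted_walk x m j - twisted_walk x m k\<bar> \<le> A * sqrt E * (2 ^ m * rate m)" by simp
    moreover have "\<bar>2 ^ m * twist_shrink x m t - twisted_walk x m k\<bar> \<le> 1"
      unfolding k_def by (rule twist_shrink_near_grid[OF t(1)])
    moreover have "\<bar>2 ^ Suc m * twist_shrink x (Suc m) t - twisted_walk x (Suc m) n\<bar> \<le> 1"
      unfolding n_def by (rule twist_shrink_near_grid[OF t(1)])
    moreover have "\<bar>twisted_walk x (Suc m) n - 2 * twisted_walk x m j\<bar> \<le> 1"
      unfolding j_def by (rule twisted_walk_refine)
    \<comment> \<open>The fine interpolation and the refinement cost 1 each and the doubled coarse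
      interpolation costs 2; halving the total leaves 2.\<close>
    ultimately have "\<bar>2 ^ m * twist_shrink x (Suc m) t - 2 ^ m * twist_shrink x m t\<bar> \<le> A * sqrt E * (2 ^ m * rate m) + 2"
      unfolding power_Suc by linarith
    then have "2 ^ m * \<bar>twist_shrink x (Suc m) t - twist_shrink x m t\<bar> \<le> A * sqrt E * (2 ^ m * rate m) + 2"
      by (simp add: abs_mult flip: right_diff_distrib)
    also have "\<dots> = 2 ^ m * (A * sqrt E * rate m + 2 * (1 / 2 ^ m))" by (simp add: algebra_simps)
    finally have "\<bar>twist_shrink x (Suc m) t - twist_shrink x m t\<bar> \<le> A * sqrt E * rate m + 2 * (1 / 2 ^ m)" by simp
    also have "\<dots> \<le> (A * sqrt E + 2) * rate m" using m1(2)[OF m] by (simp add: algebra_simps)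
    finally show "\<bar>twist_shrink x (Suc m) t - twist_shrink x m t\<bar> \<le> (A * sqrt E + 2) * rate m" .
  qed (use A E in auto)
qed

text \<open>The consecutive differences telescope against \<open>rate\<close>, and the resulting
  bound, uniform in the later level, passes to the limit at each \<open>t\<close>.\<close>

lemma twist_shrink_rate:
  fixes K :: real
  assumes "K > 0" and lim: "\<And>t. 0 \<le> t \<Longrightarrow> t \<le> K \<Longrightarrow> (\<lambda>m. twist_shrink x m t) \<longlonglongrightarrow> b t"
  obtains D m1 where "D \<ge> 0"
    "\<And>m t. m \<ge> m1 \<Longrightarrow> 0 \<le> t \<Longrightarrow> t \<le> K \<Longrightarrow> \<bar>twist_shrink x m t - b t\<bar> \<le> D * rate m"
proof -
  obtain D m1 where D: "D \<ge> 0"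
    "\<And>m t. m \<ge> m1 \<Longrightarrow> 0 \<le> t \<Longrightarrow> t \<le> K \<Longrightarrow> \<bar>twist_shrink x (Suc m) t - twist_shrink x m t\<bar> \<le> D * rate m"
    using twist_shrink_consecutive[OF assms(1)] by blast
  obtain N where N: "\<And>m. m \<ge> N \<Longrightarrow> rate (Suc m) \<le> 4/5 * rate m"
    using rate_contracts by (auto simp: eventually_sequentially)
  have "\<bar>twist_shrink x m t - b t\<bar> \<le> 5 * D * rate m" if m: "m \<ge> max m1 N" and t: "0 \<le> t" "t \<le> K" for m t
  proof -
    have tele: "\<bar>twist_shrink x m' t - twist_shrink x m t\<bar> \<le> 5 * D * (rate m - rate m')" if "m' \<ge> m" for m'
      using that
    proof (induction m' rule: dec_induct)
      case (step n)
      have "rate n \<le> 5 * (rate n - rate (Suc n))" using N[of n] step m by simp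
      then have "D * rate n \<le> D * (5 * (rate n - rate (Suc n)))" using D(1) by (rule mult_left_mono)
      then show ?case using step D(2)[of n t] t m by (simp add: algebra_simps)
    qed simp
    have "\<bar>twist_shrink x m' t - twist_shrink x m t\<bar> \<le> 5 * D * rate m" if "m' \<ge> m" for m'
      using tele[OF that] mult_nonneg_nonneg[OF D(1) rate_nonneg[of m']] by (simp add: algebra_simps)
    then have "\<bar>b t - twist_shrink x m t\<bar> \<le> 5 * D * rate m"
      by (intro LIMSEQ_le_const2[OF tendsto_rabs[OF tendsto_diff[OF lim[OF t] tendsto_const]]]) blast
    then show ?thesis by (simp add: abs_minus_commute)
  qed
  then show ?thesis using that[of "5 * D" "max m1 N"] D(1) by auto
qed

end

subsection \<open>The discrete price process\<close>

text \<open>The difference has derivative \<open>v\<^sup>2 / (1 + v)\<close>, at most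
  \<open>2 * u\<^sup>2\<close> in size since \<open>1 + v \<ge> 1/2\<close>; then the mean value
  inequality.\<close>

lemma ln_one_plus_second_order:
  fixes u :: real
  assumes "\<bar>u\<bar> \<le> 1 / 2"
  shows "\<bar>ln (1 + u) - (u - u\<^sup>2 / 2)\<bar> \<le> 2 * \<bar>u\<bar> ^ 3"
proof -
  define f where "f = (\<lambda>v::real. ln (1 + v) - (v - v\<^sup>2 / 2))"
  have der: "(f has_field_derivative v\<^sup>2 / (1 + v)) (at v within {-\<bar>u\<bar>..\<bar>u\<bar>})"
    if "v \<in> {-\<bar>u\<bar>..\<bar>u\<bar>}" for v
  proof -
    have "1 + v > 0" using that assms by auto
    then show ?thesis unfolding f_def
      by (auto intro!: derivative_eq_intros simp: field_simps power2_eq_square)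
  qed
  have bd: "norm (v\<^sup>2 / (1 + v)) \<le> 2 * \<bar>u\<bar>\<^sup>2" if "v \<in> {-\<bar>u\<bar>..\<bar>u\<bar>}" for v
  proof -
    have "1 / 2 \<le> 1 + v" using that assms by auto
    have "\<bar>v\<bar>\<^sup>2 \<le> \<bar>u\<bar>\<^sup>2" using that by (intro power_mono) auto
    have "v\<^sup>2 / (1 + v) \<le> \<bar>u\<bar>\<^sup>2 / (1 / 2)"
      using \<open>1 / 2 \<le> 1 + v\<close> \<open>\<bar>v\<bar>\<^sup>2 \<le> \<bar>u\<bar>\<^sup>2\<close> by (intro frac_le) auto
    then show ?thesis using \<open>1 / 2 \<le> 1 + v\<close> by simp
  qed
  have "norm (f u - f 0) \<le> 2 * \<bar>u\<bar>\<^sup>2 * norm (u - 0)"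
    by (rule field_differentiable_bound[OF _ der bd]) auto
  then show ?thesis by (simp add: f_def power2_eq_square power3_eq_cube)
qed

lemma exp_diff_le:
  fixes y z c :: real
  assumes "y \<le> c" "z \<le> c"
  shows "\<bar>exp y - exp z\<bar> \<le> exp c * \<bar>y - z\<bar>"
proof -
  have *: "exp y - exp z \<le> exp c * \<bar>y - z\<bar>" if "z \<le> y" "y \<le> c" for y z :: real
  proof -
    have "exp y - exp z = exp y * (1 - exp (z - y))" by (simp add: algebra_simps flip: exp_add)
    also have "\<dots> \<le> exp c * (y - z)"
    proof (intro mult_mono)
      show "1 - exp (z - y) \<le> y - z" using exp_ge_add_one_self[of "z - y"] by linarith
    qed (use that in auto)
    finally show ?thesis using that by simp
  qed
  show ?thesis
    using *[of z y] *[of y z] assms by (cases "z \<le> y") (auto simp: abs_minus_commute)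
qed

text \<open>An interpolated value is a convex combination of two neighbouring grid values.\<close>

lemma lin_interp_diff_le:
  assumes "s \<ge> 0" "\<bar>f (nat \<lfloor>s\<rfloor>) - c\<bar> \<le> e" "\<bar>f (Suc (nat \<lfloor>s\<rfloor>)) - c\<bar> \<le> e"
  shows "\<bar>lin_interp f s - c\<bar> \<le> e"
proof -
  define k \<theta> where "k = nat \<lfloor>s\<rfloor>" and "\<theta> = s - real (nat \<lfloor>s\<rfloor>)"
  have \<theta>: "0 \<le> \<theta>" "\<theta> \<le> 1" unfolding \<theta>_def using assms(1) by linarith+
  have "\<bar>lin_interp f s - c\<bar> = \<bar>(1 - \<theta>) * (f k - c) + \<theta> * (f (Suc k) - c)\<bar>"
    by (simp add: lin_interp_def Let_def k_def \<theta>_def algebra_simps)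
  also have "\<dots> \<le> (1 - \<theta>) * \<bar>f k - c\<bar> + \<theta> * \<bar>f (Suc k) - c\<bar>"
    using \<theta> by (intro order_trans[OF abs_triangle_ineq]) (simp add: abs_mult)
  also have "\<dots> \<le> (1 - \<theta>) * e + \<theta> * e"
    using \<theta> assms unfolding k_def by (intro add_mono mult_left_mono) auto
  finally show ?thesis by (simp add: algebra_simps)
qed

lemma rate_le_1: "\<forall>\<^sub>F m in sequentially. rate m \<le> 1"
  unfolding rate_def by real_asymp

section \<open>Pathwise comparison of the discrete and the continuous price\<close>

context sign_array
begin

lemma twist_shrink_grid: "twist_shrink x m (real k / 2 ^ (2 * m)) = twisted_walk x m k / 2 ^ m"
  by (simp add: twist_shrink_def lin_interp_def)

text \<open>Each factor is \<open>1 + u\<close> with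
  \<open>\<bar>u\<bar> \<le> Q * d \<le> 1/2\<close>, hence positive. As twisted steps have square
  1, \<open>u\<^sup>2\<close> is \<open>\<sigma>\<^sup>2 * d\<^sup>2\<close> up to order
  \<open>d ^ 3\<close>, which produces the Ito correction \<open>- \<sigma>\<^sup>2 / 2\<close>. The
  errors of order \<open>d ^ 3\<close> add up over \<open>k\<close> steps.\<close>

lemma price_grid_exp:
  fixes \<mu> \<sigma> s\<^sub>0 :: real
  assumes "\<sigma> \<ge> 0"
  defines "Q \<equiv> \<bar>\<mu>\<bar> + \<sigma>"
  assumes d: "d = 1 / 2 ^ m" "Q * d \<le> 1 / 2"
  shows "\<exists>y. price_grid \<mu> \<sigma> s\<^sub>0 (twist_shrink x m) m k = s\<^sub>0 * exp y \<and>
    \<bar>y - ((\<mu> - \<sigma>\<^sup>2 / 2) * (real k * d\<^sup>2) + \<sigma> * (twisted_walk x m k * d))\<bar> \<le> (2 * Q ^ 3 + Q\<^sup>2) * d * (real k * d\<^sup>2)"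
proof (induction k)
  case 0
  then show ?case by (auto intro!: exI[of _ 0])
next
  case (Suc k)
  then obtain y where y: "price_grid \<mu> \<sigma> s\<^sub>0 (twist_shrink x m) m k = s\<^sub>0 * exp y"
    "\<bar>y - ((\<mu> - \<sigma>\<^sup>2 / 2) * (real k * d\<^sup>2) + \<sigma> * (twisted_walk x m k * d))\<bar> \<le> (2 * Q ^ 3 + Q\<^sup>2) * d * (real k * d\<^sup>2)"
    by blast
  have d01: "0 < d" "d \<le> 1" unfolding d by (auto simp: field_simps)
  have "0 \<le> Q" using assms by (simp add: Q_def)
  define e where "e = twisted x m (Suc k)"
  have e: "\<bar>e\<bar> = 1" "e\<^sup>2 = 1" using twisted_sign[of "Suc k" m] by (auto simp: e_def)
  define u where "u = \<mu> * d\<^sup>2 + \<sigma> * (e * d)"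
  have "\<bar>\<mu> * d\<^sup>2\<bar> \<le> \<bar>\<mu>\<bar> * d"
    using d01 mult_left_mono[of d 1 "\<bar>\<mu>\<bar> * d"] by (simp add: abs_mult power2_eq_square mult.assoc)
  moreover have "\<bar>\<sigma> * (e * d)\<bar> = \<sigma> * d" using e d01 assms by (simp add: abs_mult)
  ultimately have uQ: "\<bar>u\<bar> \<le> Q * d" unfolding u_def Q_def
    by (intro order_trans[OF abs_triangle_ineq]) (simp add: algebra_simps)
  have "\<bar>ln (1 + u) - (u - u\<^sup>2 / 2)\<bar> \<le> 2 * \<bar>u\<bar> ^ 3"
    by (rule ln_one_plus_second_order) (use uQ d in linarith)
  also have "\<dots> \<le> 2 * (Q * d) ^ 3" using uQ by (intro mult_left_mono power_mono) auto
  finally have lnu: "\<bar>ln (1 + u) - (u - u\<^sup>2 / 2)\<bar> \<le> 2 * Q ^ 3 * d ^ 3" by (simp add: power_mult_distrib)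
  \<comment> \<open>A polynomial identity; its last summand vanishes because \<open>e\<close> is a
    sign.\<close>
  have "u\<^sup>2 - \<sigma>\<^sup>2 * d\<^sup>2 = d ^ 3 * (\<mu>\<^sup>2 * d + 2 * \<mu> * \<sigma> * e) + \<sigma>\<^sup>2 * d\<^sup>2 * (e\<^sup>2 - 1)"
    unfolding u_def by algebra
  then have "\<bar>u\<^sup>2 - \<sigma>\<^sup>2 * d\<^sup>2\<bar> = d ^ 3 * \<bar>\<mu>\<^sup>2 * d + 2 * \<mu> * \<sigma> * e\<bar>"
    using e(2) d01 by (simp add: abs_mult)
  also have "\<bar>\<mu>\<^sup>2 * d + 2 * \<mu> * \<sigma> * e\<bar> \<le> \<bar>\<mu>\<^sup>2 * d\<bar> + \<bar>2 * \<mu> * \<sigma> * e\<bar>"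
    by (rule abs_triangle_ineq)
  also have "\<dots> = \<mu>\<^sup>2 * d + 2 * \<bar>\<mu>\<bar> * \<sigma>"
    using d01 e(1) assms(1) by (simp add: abs_mult)
  also have "\<dots> \<le> Q\<^sup>2"
    using d01 mult_left_mono[of d 1 "\<mu>\<^sup>2"] zero_le_power2[of \<sigma>]
    by (simp add: Q_def power2_sum add_increasing2)
  finally have u2: "\<bar>u\<^sup>2 - \<sigma>\<^sup>2 * d\<^sup>2\<bar> \<le> Q\<^sup>2 * d ^ 3" using d01 by (simp add: mult.commute)
  have "ln (1 + u) - ((\<mu> - \<sigma>\<^sup>2 / 2) * d\<^sup>2 + \<sigma> * (e * d))
      = (ln (1 + u) - (u - u\<^sup>2 / 2)) - (u\<^sup>2 - \<sigma>\<^sup>2 * d\<^sup>2) / 2"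
    unfolding u_def by (simp add: algebra_simps diff_divide_distrib)
  moreover have "\<bar>p - q / 2\<bar> \<le> v + w" if "\<bar>p\<bar> \<le> v" "\<bar>q\<bar> \<le> w" for p q v w :: real
    using that by linarith
  from this[OF lnu u2] have "\<bar>(ln (1 + u) - (u - u\<^sup>2 / 2)) - (u\<^sup>2 - \<sigma>\<^sup>2 * d\<^sup>2) / 2\<bar> \<le> 2 * Q ^ 3 * d ^ 3 + Q\<^sup>2 * d ^ 3" .
  ultimately have step: "\<bar>ln (1 + u) - ((\<mu> - \<sigma>\<^sup>2 / 2) * d\<^sup>2 + \<sigma> * (e * d))\<bar> \<le> 2 * Q ^ 3 * d ^ 3 + Q\<^sup>2 * d ^ 3"
    by simp
  have "d\<^sup>2 = 1 / 2 ^ (2 * m)" unfolding d by (simp add: power_mult power_divide power2_eq_square flip: power_mult_distrib)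
  then have "\<mu> / 2 ^ (2 * m) + \<sigma> * (twist_shrink x m (real (Suc k) / 2 ^ (2 * m)) - twist_shrink x m (real k / 2 ^ (2 * m))) = u"
    unfolding twist_shrink_grid by (simp add: u_def e_def d add_divide_distrib del: of_nat_Suc)
  then have "price_grid \<mu> \<sigma> s\<^sub>0 (twist_shrink x m) m (Suc k) = s\<^sub>0 * exp y * (1 + u)"
    by (simp add: y(1) add.assoc del: of_nat_Suc)
  also have "1 + u = exp (ln (1 + u))" using uQ d by (subst exp_ln) linarith+
  finally have "price_grid \<mu> \<sigma> s\<^sub>0 (twist_shrink x m) m (Suc k) = s\<^sub>0 * exp (y + ln (1 + u))"
    by (simp add: exp_add mult.assoc)
  moreover have "\<bar>(y + ln (1 + u)) - ((\<mu> - \<sigma>\<^sup>2 / 2) * (real (Suc k) * d\<^sup>2) + \<sigma> * (twisted_walk x m (Suc k) * d))\<bar>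
    \<le> (2 * Q ^ 3 + Q\<^sup>2) * d * (real (Suc k) * d\<^sup>2)"
  proof -
    have "(y + ln (1 + u)) - ((\<mu> - \<sigma>\<^sup>2 / 2) * (real (Suc k) * d\<^sup>2) + \<sigma> * (twisted_walk x m (Suc k) * d))
      = (y - ((\<mu> - \<sigma>\<^sup>2 / 2) * (real k * d\<^sup>2) + \<sigma> * (twisted_walk x m k * d)))
        + (ln (1 + u) - ((\<mu> - \<sigma>\<^sup>2 / 2) * d\<^sup>2 + \<sigma> * (e * d)))"
      by (simp add: e_def algebra_simps)
    moreover have "(2 * Q ^ 3 + Q\<^sup>2) * d * (real (Suc k) * d\<^sup>2)
        = (2 * Q ^ 3 + Q\<^sup>2) * d * (real k * d\<^sup>2) + (2 * Q ^ 3 * d ^ 3 + Q\<^sup>2 * d ^ 3)"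
      by (simp add: algebra_simps power2_eq_square power3_eq_cube)
    ultimately show ?thesis using y(2) step by linarith
  qed
  ultimately show ?case by blast
qed

text \<open>A crude bound, applied at the single level \<open>m1\<close> in order to bound the limit
  path on \<open>{0..T}\<close>.\<close>

lemma twist_shrink_bounded:
  assumes "0 \<le> t" "t \<le> T"
  shows "\<bar>twist_shrink x m t\<bar> \<le> T * 4 ^ m + 1"
proof -
  define k where "k = nat \<lfloor>t * 4 ^ m\<rfloor>"
  have "real k \<le> t * 4 ^ m" unfolding k_def using assms by simp
  also have "\<dots> \<le> T * 4 ^ m" using assms by simp
  finally have "\<bar>twisted_walk x m k\<bar> \<le> T * 4 ^ m"
    using twisted_walk_increment_le[of 0 k m] by simp
  then have "2 ^ m * \<bar>twist_shrink x m t\<bar> \<le> T * 4 ^ m + 1"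
    using twist_shrink_near_grid[OF assms(1), of m] unfolding k_def[symmetric]
    by (auto simp: abs_le_iff abs_mult[symmetric] simp del: abs_mult abs_power2 intro: order_trans)
  moreover have "1 * \<bar>twist_shrink x m t\<bar> \<le> 2 ^ m * \<bar>twist_shrink x m t\<bar>"
    by (intro mult_right_mono) auto
  ultimately show ?thesis by simp
qed

text \<open>At both grid points around \<open>t\<close> the discrete exponent is within
  \<open>W * rate m\<close> of the continuous one, and \<open>exp\<close> is Lipschitz below
  \<open>Z + W\<close>; interpolation then covers \<open>t\<close> itself.\<close>

lemma discrete_price_rate:
  fixes \<mu> \<sigma> s\<^sub>0 T D :: real
  assumes "\<sigma> \<ge> 0" "s\<^sub>0 \<ge> 0" "T \<ge> 0" "D \<ge> 0"
    and rate: "\<And>m t. m \<ge> m1 \<Longrightarrow> 0 \<le> t \<Longrightarrow> t \<le> T \<Longrightarrow> \<bar>twist_shrink x m t - b t\<bar> \<le> D * rate m"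
  obtains C where "\<forall>\<^sub>F m in sequentially. \<forall>t\<in>{0..T}.
    \<bar>discrete_price \<mu> \<sigma> s\<^sub>0 (twist_shrink x m) m t - geometric_bm \<mu> \<sigma> s\<^sub>0 b t\<bar> \<le> C * rate m"
proof -
  define Q where "Q = \<bar>\<mu>\<bar> + \<sigma>"
  define G where "G = 2 * Q ^ 3 + Q\<^sup>2"
  define c where "c = \<mu> - \<sigma>\<^sup>2 / 2"
  \<comment> \<open>The summands account for the logarithmic expansion, for moving the drift from
    \<open>t\<close> to a grid point, and for the walk: 2 for grid and interpolation,
    \<open>D\<close> for the distance to the limit.\<close>
  define W where "W = G * (T + 1) + \<bar>c\<bar> + \<sigma> * (2 + D)"
  define Bmax where "Bmax = T * 4 ^ m1 + 1 + D * rate m1"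
  define Z where "Z = \<bar>c\<bar> * T + \<sigma> * Bmax"
  have Q: "Q \<ge> 0" and G: "G \<ge> 0" using assms by (auto simp: Q_def G_def)
  have W: "W \<ge> 0" unfolding W_def using G assms by (intro add_nonneg_nonneg mult_nonneg_nonneg) auto
  have Z: "c * t + \<sigma> * b t \<le> Z" if "t \<in> {0..T}" for t
  proof -
    have "\<bar>b t\<bar> \<le> Bmax"
      using rate[of m1 t] twist_shrink_bounded[of t T m1] that unfolding Bmax_def by auto
    then have "\<sigma> * b t \<le> \<sigma> * Bmax" using assms by (intro mult_left_mono) auto
    moreover have "c * t \<le> \<bar>c\<bar> * T" using that by (intro mult_mono) auto
    ultimately show ?thesis by (simp add: Z_def)
  qed
  have "\<forall>\<^sub>F m in sequentially. Q * (1 / 2 ^ m) \<le> 1 / 2" by real_asymp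
  then have "\<forall>\<^sub>F m in sequentially. Q * (1 / 2 ^ m) \<le> 1 / 2 \<and> 1 / 2 ^ m \<le> rate m \<and> rate m \<le> 1 \<and> m \<ge> m1"
    by (intro eventually_conj inverse_power_le_rate rate_le_1 eventually_ge_at_top)
  then have "\<forall>\<^sub>F m in sequentially. \<forall>t\<in>{0..T}.
    \<bar>discrete_price \<mu> \<sigma> s\<^sub>0 (twist_shrink x m) m t - geometric_bm \<mu> \<sigma> s\<^sub>0 b t\<bar> \<le> s\<^sub>0 * exp (Z + W) * W * rate m"
  proof eventually_elim
    case (elim m)
    define d :: real where "d = 1 / 2 ^ m"
    have d01: "0 < d" "d \<le> 1" unfolding d_def by (auto simp: field_simps)
    have dr: "d \<le> rate m" and Qd: "Q * d \<le> 1 / 2" using elim by (auto simp: d_def)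
    have "d * d \<le> d" using d01 mult_left_mono[of d 1 d] by simp
    have d4: "d\<^sup>2 * 4 ^ m = 1" unfolding d_def by (simp add: power_divide power2_eq_square flip: power_mult_distrib)
    show ?case
    proof
      fix t assume t: "t \<in> {0..T}"
      define k where "k = nat \<lfloor>t * 4 ^ m\<rfloor>"
      define z where "z = c * t + \<sigma> * b t"
      have kt: "real k \<le> t * 4 ^ m" "t * 4 ^ m \<le> real k + 1"
        unfolding k_def using t by (simp, linarith?)+
      have near: "\<bar>price_grid \<mu> \<sigma> s\<^sub>0 (twist_shrink x m) m j - s\<^sub>0 * exp z\<bar> \<le> s\<^sub>0 * exp (Z + W) * W * rate m"
        if j: "j = k \<or> j = Suc k" for j
      proof -
        obtain y where y: "price_grid \<mu> \<sigma> s\<^sub>0 (twist_shrink x m) m j = s\<^sub>0 * exp y"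
          "\<bar>y - (c * (real j * d\<^sup>2) + \<sigma> * (twisted_walk x m j * d))\<bar> \<le> G * d * (real j * d\<^sup>2)"
          using price_grid_exp[OF assms(1) d_def, of \<mu> s\<^sub>0 j] Qd unfolding Q_def G_def c_def by blast
        have "\<bar>real j - t * 4 ^ m\<bar> * d\<^sup>2 \<le> 1 * d\<^sup>2"
          using j kt by (intro mult_right_mono) auto
        moreover have "\<bar>real j - t * 4 ^ m\<bar> * d\<^sup>2 = \<bar>(real j - t * 4 ^ m) * d\<^sup>2\<bar>" by (simp add: abs_mult)
        moreover have "(real j - t * 4 ^ m) * d\<^sup>2 = real j * d\<^sup>2 - t * (d\<^sup>2 * 4 ^ m)" by (simp add: algebra_simps)
        ultimately have jt: "\<bar>real j * d\<^sup>2 - t\<bar> \<le> d"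
          unfolding d4 using \<open>d * d \<le> d\<close> by (simp add: power2_eq_square)
        \<comment> \<open>The grid point \<open>j\<close> may lie just beyond \<open>t\<close>,
          hence \<open>T + 1\<close>.\<close>
        have "G * d * (real j * d\<^sup>2) \<le> G * d * (T + 1)"
          using jt d01 t G by (intro mult_left_mono) auto
        moreover have "\<bar>c * (real j * d\<^sup>2) - c * t\<bar> \<le> \<bar>c\<bar> * d"
          using mult_left_mono[OF jt, of "\<bar>c\<bar>"] by (simp add: abs_mult[symmetric] right_diff_distrib)
        moreover have "\<bar>\<sigma> * (twisted_walk x m j * d) - \<sigma> * b t\<bar> \<le> \<sigma> * (2 * d + D * rate m)"
        proof -
          have "\<bar>twisted_walk x m j - twisted_walk x m k\<bar> \<le> 1"
            using j twisted_walk_increment_le[of k "Suc k" m] by auto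
          moreover have "\<bar>2 ^ m * twist_shrink x m t - twisted_walk x m k\<bar> \<le> 1"
            unfolding k_def by (rule twist_shrink_near_grid) (use t in auto)
          ultimately have "\<bar>twisted_walk x m j - 2 ^ m * twist_shrink x m t\<bar> \<le> 2" by linarith
          then have "\<bar>twisted_walk x m j - 2 ^ m * twist_shrink x m t\<bar> * d \<le> 2 * d"
            using d01 by (intro mult_right_mono) auto
          moreover have "\<bar>twisted_walk x m j - 2 ^ m * twist_shrink x m t\<bar> * d
              = \<bar>(twisted_walk x m j - 2 ^ m * twist_shrink x m t) * d\<bar>"
            using d01 by (simp add: abs_mult)
          moreover have "(twisted_walk x m j - 2 ^ m * twist_shrink x m t) * d = twisted_walk x m j * d - twist_shrink x m t"
            by (simp add: d_def field_simps)
          ultimately have "\<bar>twisted_walk x m j * d - twist_shrink x m t\<bar> \<le> 2 * d" by simp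
          moreover have "\<bar>twist_shrink x m t - b t\<bar> \<le> D * rate m"
            using rate[of m t] elim t by auto
          ultimately have "\<bar>twisted_walk x m j * d - b t\<bar> \<le> 2 * d + D * rate m" by linarith
          from mult_left_mono[OF this assms(1)] show ?thesis
            using assms(1) by (simp add: abs_mult flip: right_diff_distrib)
        qed
        ultimately have "\<bar>y - z\<bar> \<le> G * d * (T + 1) + \<bar>c\<bar> * d + \<sigma> * (2 * d + D * rate m)"
          using y(2) unfolding z_def by linarith
        also have "\<dots> \<le> G * rate m * (T + 1) + \<bar>c\<bar> * rate m + \<sigma> * (2 * rate m + D * rate m)"
          using dr G assms by (intro add_mono mult_left_mono mult_right_mono) auto
        also have "\<dots> = W * rate m" by (simp add: W_def algebra_simps)
        finally have yz: "\<bar>y - z\<bar> \<le> W * rate m" .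
        have "W * rate m \<le> W * 1" using elim W by (intro mult_left_mono) auto
        then have "y \<le> Z + W" "z \<le> Z + W" using yz Z[OF t] W unfolding z_def by auto
        then have "\<bar>exp y - exp z\<bar> \<le> exp (Z + W) * \<bar>y - z\<bar>" by (rule exp_diff_le)
        also have "\<dots> \<le> exp (Z + W) * (W * rate m)" using yz by (intro mult_left_mono) auto
        finally have "s\<^sub>0 * \<bar>exp y - exp z\<bar> \<le> s\<^sub>0 * (exp (Z + W) * (W * rate m))"
          using assms by (intro mult_left_mono) auto
        then show ?thesis
          unfolding y(1) using assms by (simp add: abs_mult mult.assoc flip: right_diff_distrib)
      qed
      show "\<bar>discrete_price \<mu> \<sigma> s\<^sub>0 (twist_shrink x m) m t - geometric_bm \<mu> \<sigma> s\<^sub>0 b t\<bar>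
          \<le> s\<^sub>0 * exp (Z + W) * W * rate m"
        unfolding discrete_price_def geometric_bm_def c_def[symmetric] z_def[symmetric]
        by (rule lin_interp_diff_le) (use t near[of k] near[of "Suc k"] in \<open>auto simp: k_def power_mult\<close>)
    qed
  qed
  then show ?thesis by (rule that)
qed

end

section \<open>Passage from single outcomes to the almost sure statement\<close>

theorem mainTheorem5:
  fixes M :: "'a measure"
    and X :: "nat \<Rightarrow> nat \<Rightarrow> 'a \<Rightarrow> real"
    and B :: "real \<Rightarrow> 'a \<Rightarrow> real"
    and \<mu> \<sigma> s\<^sub>0 T :: real
  assumes "prob_space M" and "complete_measure M"
    and "prob_space.indep_vars M (\<lambda>_. borel) (\<lambda>(m, k). X m k) (UNIV \<times> {1..})"
    and "\<And>m k. k \<ge> 1 \<Longrightarrow> measure M {\<omega> \<in> space M. X m k \<omega> = 1} = 1 / 2"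
    and "\<And>m k. k \<ge> 1 \<Longrightarrow> measure M {\<omega> \<in> space M. X m k \<omega> = - 1} = 1 / 2"
    and "prob_space.brownian_motion M B"
    and "AE \<omega> in M. \<forall>K>0. uniform_limit {0..K}
           (\<lambda>m. twist_shrink (\<lambda>i k. X i k \<omega>) m) (\<lambda>t. B t \<omega>) sequentially"
    and "\<sigma> > 0" and "s\<^sub>0 > 0" and "T > 0"
  shows "AE \<omega> in M.
    (\<lambda>m. SUP t\<in>{0..T}. \<bar>discrete_price \<mu> \<sigma> s\<^sub>0 (twist_shrink (\<lambda>i k. X i k \<omega>) m) m t
                          - geometric_bm \<mu> \<sigma> s\<^sub>0 (\<lambda>u. B u \<omega>) t\<bar>)
      \<in> O(\<lambda>m. real m powr (3 / 4) * 2 powr (- real m / 2))"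
proof -
  interpret prob_space M by fact
  define Z where "Z = (\<lambda>r l \<omega>. X r (2 * l - 1) \<omega> * X r (2 * l) \<omega>)"
  have ind: "indep_vars (\<lambda>_. borel) (X m) {1..}" for m
  proof -
    \<comment> \<open>Row \<open>m\<close> is extracted from the doubly indexed family through the
      disjoint singletons \<open>{(m, k)}\<close>.\<close>
    have "indep_vars (\<lambda>k. PiM {(m, k)} (\<lambda>_. borel))
        (\<lambda>k \<omega>. restrict (\<lambda>i. (case i of (i, k) \<Rightarrow> X i k) \<omega>) {(m, k)}) {1..}"
      by (rule indep_vars_restrict[OF assms(3)]) (auto simp: disjoint_family_on_def)
    then have "indep_vars (\<lambda>_. borel)
        (\<lambda>k \<omega>. (\<lambda>f. f (m, k)) (restrict (\<lambda>i. (case i of (i, k) \<Rightarrow> X i k) \<omega>) {(m, k)})) {1..}"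
      by (rule indep_vars_compose2) simp
    then show ?thesis by simp
  qed
  have rv: "random_variable borel (X m k)" if "k \<ge> 1" for m k
    using ind[of m] that unfolding indep_vars_def by auto
  have sgn: "AE \<omega> in M. X m k \<omega> = 1 \<or> X m k \<omega> = -1" if "k \<ge> 1" for m k
    by (rule random_sign_AE) (use rv assms that in auto)
  have Zind: "indep_vars (\<lambda>_. borel) (Z r) {1..}" for r
    unfolding Z_def by (rule pair_products_indep_centred(1)[OF ind assms(4,5)])
  have Zmean: "expectation (Z r l) = 0" if "l \<ge> 1" for r l
    unfolding Z_def by (rule pair_products_indep_centred(2)[OF ind assms(4,5) that])
  have Zbd: "AE \<omega> in M. \<bar>Z r l \<omega>\<bar> \<le> 1" if "l \<ge> 1" for r l
  proof -
    have "2 * l - 1 \<ge> 1" "2 * l \<ge> 1" using that by auto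
    from sgn[OF this(1), of r] sgn[OF this(2), of r] show ?thesis
      by eventually_elim (auto simp: Z_def)
  qed
  have "AE \<omega> in M. \<forall>m. \<forall>k\<in>{1..}. X m k \<omega> = 1 \<or> X m k \<omega> = -1"
    by (simp add: AE_all_countable AE_ball_countable) (use sgn in auto)
  moreover have "AE \<omega> in M. \<forall>m. \<forall>\<^sub>F n in sequentially. \<bar>\<Sum>l=1..n. Z m l \<omega>\<bar> \<le> real n / 2"
    unfolding AE_all_countable by (intro allI AE_eventually_partial_sums_le Zind Zbd Zmean)
  moreover have "AE \<omega> in M. \<forall>\<^sub>F r in sequentially. \<forall>b\<le>8 ^ r. \<forall>a\<le>b.
           \<bar>\<Sum>l\<in>{a<..b}. Z r l \<omega>\<bar> \<le> 4 * sqrt (real r * (real b - real a))"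
    by (intro AE_eventually_block_sums_le Zind Zbd Zmean)
  ultimately show ?thesis
    using assms(7)
  proof eventually_elim
    case (elim \<omega>)
    define x where "x = (\<lambda>m k. X m k \<omega>)"
    have sign: "x m k = 1 \<or> x m k = -1" if "k \<ge> 1" for m k
      using elim(1) that by (auto simp: x_def)
    have unb: "\<exists>n. k \<le> pair_count (x m) n" for m k
    proof -
      have "\<forall>\<^sub>F n in sequentially. \<bar>\<Sum>l=1..n. Z m l \<omega>\<bar> \<le> real n / 2 \<and> n \<ge> 4 * k"
        using elim(2) by (intro eventually_conj eventually_ge_at_top) auto
      then obtain n where n: "\<bar>\<Sum>l=1..n. Z m l \<omega>\<bar> \<le> real n / 2" "n \<ge> 4 * k"
        by (auto simp: eventually_sequentially)
      have "{0<..n} = {1..n}" by auto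
      \<comment> \<open>The sum is at least \<open>- n / 2\<close>, so the count is at least
        \<open>n / 4\<close>, and \<open>n \<ge> 4 * k\<close>.\<close>
      then have "real (pair_count (x m) n) = real n / 2 + (\<Sum>l=1..n. Z m l \<omega>) / 2"
        using pair_count_diff[of "x m", OF sign, of 0 n] by (simp add: Z_def x_def)
      with n have "real k \<le> real (pair_count (x m) n)" by linarith
      then show ?thesis by auto
    qed
    obtain r0 where r0: "\<And>r b a. r \<ge> r0 \<Longrightarrow> b \<le> 8 ^ r \<Longrightarrow> a \<le> b \<Longrightarrow>
        \<bar>\<Sum>l\<in>{a<..b}. Z r l \<omega>\<bar> \<le> 4 * sqrt (real r * (real b - real a))"
      using elim(3) unfolding eventually_sequentially by blast
    interpret concentrated_sign_array x r0
      by unfold_locales (use sign unb r0 in \<open>auto simp: x_def Z_def\<close>)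
    have "uniform_limit {0..T} (twist_shrink x) (\<lambda>t. B t \<omega>) sequentially"
      using elim(4) \<open>T > 0\<close> unfolding x_def by auto
    then have lim: "(\<lambda>m. twist_shrink x m t) \<longlonglongrightarrow> B t \<omega>" if "0 \<le> t" "t \<le> T" for t
      by (rule tendsto_uniform_limitI) (use that in auto)
    obtain D m1 where D: "D \<ge> 0"
      "\<And>m t. m \<ge> m1 \<Longrightarrow> 0 \<le> t \<Longrightarrow> t \<le> T \<Longrightarrow> \<bar>twist_shrink x m t - B t \<omega>\<bar> \<le> D * rate m"
      using twist_shrink_rate[of T "\<lambda>t. B t \<omega>", OF \<open>T > 0\<close> lim] by blast
    obtain C where C: "\<forall>\<^sub>F m in sequentially. \<forall>t\<in>{0..T}.
        \<bar>discrete_price \<mu> \<sigma> s\<^sub>0 (twist_shrink x m) m t - geometric_bm \<mu> \<sigma> s\<^sub>0 (\<lambda>u. B u \<omega>) t\<bar> \<le> C * rate m"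
      by (rule discrete_price_rate[of \<sigma> s\<^sub>0 T D m1 "\<lambda>u. B u \<omega>" \<mu>]) (use D assms in auto)
    have "(\<lambda>m. SUP t\<in>{0..T}. \<bar>discrete_price \<mu> \<sigma> s\<^sub>0 (twist_shrink x m) m t - geometric_bm \<mu> \<sigma> s\<^sub>0 (\<lambda>u. B u \<omega>) t\<bar>)
        \<in> O(rate)"
    proof (rule bigoI)
      show "\<forall>\<^sub>F m in sequentially. norm (SUP t\<in>{0..T}. \<bar>discrete_price \<mu> \<sigma> s\<^sub>0 (twist_shrink x m) m t
          - geometric_bm \<mu> \<sigma> s\<^sub>0 (\<lambda>u. B u \<omega>) t\<bar>) \<le> C * norm (rate m)"
        using C
      proof eventually_elim
        case (elim m)
        define F where "F = (\<lambda>t. \<bar>discrete_price \<mu> \<sigma> s\<^sub>0 (twist_shrink x m) m t - geometric_bm \<mu> \<sigma> s\<^sub>0 (\<lambda>u. B u \<omega>) t\<bar>)"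
        have "(SUP t\<in>{0..T}. F t) \<le> C * rate m"
          by (rule cSUP_least) (use elim \<open>T > 0\<close> in \<open>auto simp: F_def\<close>)
        \<comment> \<open>Shows that the supremum is nonnegative, so its norm is the supremum
          itself.\<close>
        moreover have "F 0 \<le> (SUP t\<in>{0..T}. F t)"
          by (rule cSUP_upper) (use elim \<open>T > 0\<close> in \<open>auto simp: F_def intro!: bdd_aboveI[of _ "C * rate m"]\<close>)
        moreover have "0 \<le> F 0" by (simp add: F_def)
        ultimately show ?case using rate_nonneg[of m] by (simp add: F_def)
      qed
    qed
    then show ?case unfolding x_def rate_def[abs_def] .
  qed
qed

end
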